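(* Let $d\ge 2$ and $\beta>2$, and let $(Z(t))_{t\ge 0}$ be the orthogonal continuous-time conservative walk (Model A) on $\mathbb{R}^d$ generated by the rate function $$\lambda(t)=\begin{cases}\dfrac{1}{(\ln t)^{\beta}}, & t\ge e,\\[2mm] 0,&\text{otherwise.}\end{cases}$$ Then $Z(t)$ is transient almost surely.
   Context: Model A (orthogonal conservative walk) on $\mathbb{R}^d$: Let $\lambda\ge 0$ be a rate function with $\Lambda(T)=\int_0^T\lambda(t)\,dt<\infty$ for all $T\ge 0$ and $\Lambda(T)\to\infty$ as $T\to\infty$. Let $\tau_0=0$ and let $\tau_1<\tau_2<\dots$ be the consecutive points of a non-homogeneous Poisson point process on $[0,\infty)$ with rate $\lambda(t)$. Let $\mathbf f_0,\mathbf f_1,\mathbf f_2,\dots$ be i.i.d. random vectors, independent of $(\tau_k)_{k\ge1}$, each uniformly distributed on the set of $2d$ unit vectors $\{\pm \mathbf e_1,\dots,\pm\mathbf e_d\}$ of $\mathbb{R}^d$. With $N(t)=\sup\{k\ge 0:\tau_k\le t\}$, the walk is $$Z(t)=\sum_{k=0}^{N(t)-1}(\tau_{k+1}-\tau_k)\mathbf f_k+(t-\tau_{N(t)})\mathbf f_{N(t)},\qquad t\ge 0.$$ Transience: for $\rho\ge 0$, $Z(t)$ is $\rho$-recurrent if there is an infinite sequence of times $t_1<t_2<\dots$ converging to infinity with $Z(t_i)\in[-\rho,\rho]^d$ for all $i$. $Z(t)$ is transient if it is not $\rho$-recurrent for any $\rho>0$, equivalently $\lim_{t\to\infty}\|Z(t)\|=\infty$.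 *)

theory Defs
  imports "HOL-Probability.Probability" "HOL-Real_Asymp.Real_Asymp"
begin

text \<open>The conditions on the cumulative rate make the means of the Poisson counts below finite
  and make the number of points infinite.\<close>

definition rate_function :: "(real \<Rightarrow> real) \<Rightarrow> bool" where
  "rate_function rate \<longleftrightarrow>
     (\<forall>t. 0 \<le> rate t) \<and>
     (\<forall>T\<ge>0. set_integrable lborel {0..T} rate) \<and>
     filterlim (\<lambda>T. LINT t:{0..T}|lborel. rate t) at_top at_top"

text \<open>The points are \<open>\<tau> 1, \<tau> 2, \<dots>\<close>; the origin \<open>\<tau> 0 = 0\<close> is not a point of the process.\<close>

definition point_count :: "(nat \<Rightarrow> 'w \<Rightarrow> real) \<Rightarrow> real set \<Rightarrow> 'w \<Rightarrow> nat" where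
  "point_count \<tau> A \<omega> = card {k. 1 \<le> k \<and> \<tau> k \<omega> \<in> A}"

text \<open>\<open>\<tau>\<close> enumerates, in increasing order, the points of a Poisson process with intensity
  \<open>rate\<close>. Divergence of \<open>\<tau>\<close> is local finiteness of the point set; it ensures that
  \<open>point_count\<close> is (almost surely) the cardinality of a finite set. The Poisson probabilities
  are written out because the mean may be \<open>0\<close>.\<close>

locale poisson_points = prob_space M
  for M :: "'w measure" and rate :: "real \<Rightarrow> real" and \<tau> :: "nat \<Rightarrow> 'w \<Rightarrow> real" +
  assumes rate: "rate_function rate"
    and arrival_0: "\<And>\<omega>. \<omega> \<in> space M \<Longrightarrow> \<tau> 0 \<omega> = 0"
    and arrival_measurable: "\<And>k. \<tau> k \<in> borel_measurable M"
    and arrivals_increasing: "AE \<omega> in M. strict_mono (\<lambda>k. \<tau> k \<omega>)"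
    and arrivals_diverge: "AE \<omega> in M. filterlim (\<lambda>k. \<tau> k \<omega>) at_top sequentially"
    and count_poisson: "\<And>A n. A \<in> sets borel \<Longrightarrow> bounded A \<Longrightarrow> A \<subseteq> {0..} \<Longrightarrow>
      prob {\<omega> \<in> space M. point_count \<tau> A \<omega> = n} =
        (LINT t:A|lborel. rate t) ^ n / fact n * exp (- (LINT t:A|lborel. rate t))"
    and count_indep: "\<And>(A :: nat \<Rightarrow> real set) n.
      (\<And>i. i < n \<Longrightarrow> A i \<in> sets borel \<and> bounded (A i) \<and> A i \<subseteq> {0..}) \<Longrightarrow>
      disjoint_family_on A {..<n} \<Longrightarrow>
      indep_vars (\<lambda>_. count_space UNIV) (\<lambda>i. point_count \<tau> (A i)) {..<n}"

definition signed_axes :: "(real ^ 'd) set" where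
  "signed_axes = {v. \<exists>j. v = axis j 1 \<or> v = - axis j 1}"

text \<open>The independence of the two sequences is stated through the \<open>\<sigma>\<close>-algebras they generate,
  since \<open>prob_space.indep_var\<close> requires both variables to have values in the same type.\<close>

locale orthogonal_conservative_walk = poisson_points M rate \<tau>
  for M :: "'w measure" and rate :: "real \<Rightarrow> real" and \<tau> :: "nat \<Rightarrow> 'w \<Rightarrow> real" +
  fixes f :: "nat \<Rightarrow> 'w \<Rightarrow> real ^ 'd"
  assumes directions_indep: "indep_vars (\<lambda>_. borel) f UNIV"
    and directions_uniform: "\<And>k v. v \<in> signed_axes \<Longrightarrow>
      prob {\<omega> \<in> space M. f k \<omega> = v} = 1 / (2 * real CARD('d))"
    and directions_indep_arrivals:
      "indep_set
         {(\<lambda>\<omega> k. \<tau> (Suc k) \<omega>) -` A \<inter> space M | A. A \<in> sets (Pi\<^sub>M UNIV (\<lambda>_. borel))}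
         {(\<lambda>\<omega> k. f k \<omega>) -` B \<inter> space M | B. B \<in> sets (Pi\<^sub>M UNIV (\<lambda>_. borel))}"

definition num_arrivals :: "(nat \<Rightarrow> 'w \<Rightarrow> real) \<Rightarrow> real \<Rightarrow> 'w \<Rightarrow> nat" where
  "num_arrivals \<tau> t \<omega> = Sup {k. \<tau> k \<omega> \<le> t}"

definition walk ::
  "(nat \<Rightarrow> 'w \<Rightarrow> real) \<Rightarrow> (nat \<Rightarrow> 'w \<Rightarrow> real ^ 'd) \<Rightarrow> real \<Rightarrow> 'w \<Rightarrow> real ^ 'd" where
  "walk \<tau> f t \<omega> =
     (\<Sum>k<num_arrivals \<tau> t \<omega>. (\<tau> (Suc k) \<omega> - \<tau> k \<omega>) *\<^sub>R f k \<omega>) +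
     (t - \<tau> (num_arrivals \<tau> t \<omega>) \<omega>) *\<^sub>R f (num_arrivals \<tau> t \<omega>) \<omega>"

definition recurrent_path :: "real \<Rightarrow> (real \<Rightarrow> real ^ 'd) \<Rightarrow> bool" where
  "recurrent_path \<rho> z \<longleftrightarrow>
     (\<exists>s :: nat \<Rightarrow> real. (\<forall>i. 0 \<le> s i) \<and> strict_mono s \<and> filterlim s at_top sequentially \<and>
        (\<forall>i. z (s i) \<in> {x. \<forall>j. x $ j \<in> {-\<rho>..\<rho>}}))"

definition transient_path :: "(real \<Rightarrow> real ^ 'd) \<Rightarrow> bool" where
  "transient_path z \<longleftrightarrow> (\<forall>\<rho>>0. \<not> recurrent_path \<rho> z)"

definition log_rate :: "real \<Rightarrow> real \<Rightarrow> real" where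
  "log_rate \<beta> t = (if exp 1 \<le> t then 1 / ln t powr \<beta> else 0)"

lemma log_rate_bounds:
  assumes "0 \<le> \<beta>"
  shows "0 \<le> log_rate \<beta> t" "log_rate \<beta> t \<le> 1"
proof -
  show "0 \<le> log_rate \<beta> t" by (simp add: log_rate_def)
  have "1 \<le> ln t powr \<beta>" if t: "exp 1 \<le> t"
  proof -
    have "0 < t" using t exp_gt_zero[of "1::real"] by linarith
    hence "1 \<le> ln t" using t by (simp add: ln_ge_iff)
    thus ?thesis using assms by (rule ge_one_powr_ge_zero)
  qed
  thus "log_rate \<beta> t \<le> 1" by (auto simp: log_rate_def divide_simps)
qed

lemma log_rate_measurable: "log_rate \<beta> \<in> borel_measurable borel"
  unfolding log_rate_def[abs_def] by measurable

lemma set_integrable_log_rate: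
  assumes "0 \<le> \<beta>"
  shows "set_integrable lborel {a..b} (log_rate \<beta>)"
proof (rule set_integrable_bound)
  show "set_integrable lborel {a..b} (\<lambda>_. 1 :: real)"
    by (rule borel_integrable_atLeastAtMost') simp
  show "set_borel_measurable lborel {a..b} (log_rate \<beta>)"
    unfolding set_borel_measurable_def using log_rate_measurable by simp
  show "AE x in lborel. x \<in> {a..b} \<longrightarrow> norm (log_rate \<beta> x) \<le> norm (1 :: real)"
    using log_rate_bounds[OF assms] by auto
qed

lemma rate_function_log_rate:
  assumes "0 \<le> \<beta>"
  shows "rate_function (log_rate \<beta>)"
proof -
  have lower: "(T - exp 1) / ln T powr \<beta> \<le> (LINT t:{0..T}|lborel. log_rate \<beta> t)"
    if T: "exp 1 \<le> T" for T
  proof -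
    have "(T - exp 1) / ln T powr \<beta> = (LINT t:{exp 1..T}|lborel. 1 / ln T powr \<beta>)"
      using T by (simp add: set_lebesgue_integral_def)
    also have "\<dots> \<le> (LINT t:{exp 1..T}|lborel. log_rate \<beta> t)"
    proof (rule set_integral_mono)
      show "set_integrable lborel {exp 1..T} (\<lambda>_. 1 / ln T powr \<beta>)"
        by (rule borel_integrable_atLeastAtMost') simp
      show "set_integrable lborel {exp 1..T} (log_rate \<beta>)"
        by (rule set_integrable_log_rate[OF assms])
      fix t assume t: "t \<in> {exp 1..T}"
      have pos: "0 < t" using t exp_gt_zero[of "1::real"] unfolding atLeastAtMost_iff by linarith
      have "1 \<le> ln t" using t pos by (simp add: ln_ge_iff)
      moreover have "ln t \<le> ln T" using t pos by simp
      ultimately have "ln t powr \<beta> \<le> ln T powr \<beta>" "0 < ln t powr \<beta>"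
        using assms by (auto intro: powr_mono2)
      thus "1 / ln T powr \<beta> \<le> log_rate \<beta> t"
        using t by (simp add: log_rate_def frac_le)
    qed
    also have "\<dots> \<le> (LINT t:{0..T}|lborel. log_rate \<beta> t)"
      unfolding set_lebesgue_integral_def
    proof (rule integral_mono)
      fix t :: real
      have "0 \<le> t" if "exp 1 \<le> t" using that exp_gt_zero[of "1::real"] by linarith
      thus "indicator {exp 1..T} t *\<^sub>R log_rate \<beta> t \<le> indicator {0..T} t *\<^sub>R log_rate \<beta> t"
        using log_rate_bounds(1)[OF assms] by (auto simp: indicator_def)
    qed (use set_integrable_log_rate[OF assms] in \<open>simp_all add: set_integrable_def\<close>)
    finally show ?thesis .
  qed
  have "filterlim (\<lambda>T. (T - exp 1) / ln T powr \<beta>) at_top at_top" by real_asymp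
  hence "filterlim (\<lambda>T. LINT t:{0..T}|lborel. log_rate \<beta> t) at_top at_top"
    by (rule filterlim_at_top_mono)
      (use lower in \<open>auto simp: eventually_at_top_linorder\<close>)
  thus ?thesis
    using log_rate_bounds[OF assms] set_integrable_log_rate[OF assms]
    by (simp add: rate_function_def)
qed

end

theory Submission imports Defs begin

text \<open>
  The walk moves with unit speed, so a path that visits a bounded box at arbitrarily late times
  also visits a slightly larger box at infinitely many integer times. By the Borel-Cantelli lemma it
  is enough that, for two distinct coordinates \<open>i\<close>, \<open>j\<close> and every \<open>R\<close>, the probabilities of
  \<open>\<bar>Z\<^sub>i(n)\<bar> \<le> R \<and> \<bar>Z\<^sub>j(n)\<bar> \<le> R\<close> are summable over the integers \<open>n\<close>. Up to time \<open>n\<close> the walk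
  makes about \<open>n / L\<close> steps of typical length \<open>L = (ln n)\<^sup>\<beta>\<close>, so each coordinate spreads over the scale
  \<open>sqrt (n * L)\<close>, and the probability should be of order \<open>1 / (n * L)\<close>, which is summable. The
  lemma \<open>prob_near_origin_le\<close> proves this up to an error of order \<open>L\<^sup>4 / n\<^sup>2\<close>.

  The bound comes from Fourier analysis. The indicator of \<open>[-R, R]\<close> is at most a constant times
  \<open>exp (- x\<^sup>2 / 2)\<close>, and this is the average of \<open>exp (\<i> g x)\<close> over a standard normal \<open>g\<close>. So the
  probability is at most a constant times the average of \<open>\<bar>E exp (\<i> (g Z\<^sub>i + h Z\<^sub>j))\<bar>\<close> over two
  independent standard normal variables \<open>g\<close>, \<open>h\<close> (\<open>small_ball_le_gaussian_average\<close>).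

  Given the arrival times, \<open>Z(n)\<close> is a sum of independent vectors, one for each step, and the
  characteristic function is a product. A step of length \<open>x\<close> with \<open>\<bar>x * g\<bar> \<le> 1\<close> contributes a
  factor of modulus at most \<open>1 - (x * g)\<^sup>2 / (4 * d)\<close>, because with probability \<open>1 / d\<close> its direction is
  \<open>\<plusminus> e\<^sub>i\<close> and the two signs average to \<open>cos (x * g)\<close>; all other factors have modulus at most
  \<open>1\<close>. To find many steps of a controlled length, the interval from \<open>n / 2\<close> to \<open>n\<close> is cut into
  blocks of three cells of length \<open>l \<le> L\<close>. If the first and the third cell of a block contain
  points and the second contains none, then the step that leaves the first cell has length between \<open>l\<close>
  and \<open>3 * l\<close>. Different blocks are independent, and each has this property with probability at
  least a multiple of \<open>(l / L)\<^sup>2\<close>. With about \<open>n / (6 * l)\<close> blocks the characteristic function is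
  at most \<open>exp (- \<kappa> * n * l\<^sup>3 * g\<^sup>2 / L\<^sup>2)\<close> as long as \<open>3 * l * \<bar>g\<bar> \<le> 1\<close>.

  The cell length depends on the frequency. For \<open>\<bar>g\<bar> \<le> 1 / (3 * L)\<close> the choice \<open>l = L\<close> gives the
  Gaussian factor \<open>exp (- \<kappa> * n * L * g\<^sup>2)\<close>, whose average over \<open>g\<close> is of order \<open>1 / sqrt (n * L)\<close>. For
  larger \<open>\<bar>g\<bar>\<close> a step of length \<open>L\<close> may turn the phase by a multiple of \<open>\<pi>\<close> and is of no use, so
  \<open>l = 1 / (3 * \<bar>g\<bar>)\<close> is taken; such short steps are rare, but there are so many blocks that the
  contribution is still negligible (\<open>norm_char_log_rate_le\<close>). The same bound holds with \<open>h\<close> in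
  place of \<open>g\<close>, hence also with the geometric mean of the two bounds, and the double average
  factorizes.
\<close>

section \<open>Paths of the walk\<close>

definition arrival_path :: "(nat \<Rightarrow> real) \<Rightarrow> bool" where
  "arrival_path s \<longleftrightarrow> s 0 = 0 \<and> strict_mono s \<and> filterlim s at_top sequentially"

text \<open>For increasing \<open>s\<close>, the length of the part of \<open>[s k, s (Suc k)]\<close> that lies before time \<open>t\<close>. With these clipped
  lengths the position at any time is one sum over all steps, and the last, incomplete step needs no
  separate treatment.\<close>

definition gap :: "(nat \<Rightarrow> real) \<Rightarrow> real \<Rightarrow> nat \<Rightarrow> real" where
  "gap s t k = min (s (Suc k)) t - min (s k) t"

lemma finite_arrivals_le:
  assumes "arrival_path s"
  shows "finite {k. s k \<le> t}"
proof -
  have "eventually (\<lambda>k. t < s k) sequentially"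
    using assms by (auto simp: arrival_path_def filterlim_at_top_dense)
  then obtain K where "\<And>k. k \<ge> K \<Longrightarrow> t < s k"
    by (auto simp: eventually_sequentially)
  hence "{k. s k \<le> t} \<subseteq> {..<K}"
    by (metis (mono_tags) lessThan_iff mem_Collect_eq not_le subsetI)
  thus ?thesis by (rule finite_subset) simp
qed

lemma arrivals_le_eq_atMost:
  assumes "arrival_path (\<lambda>k. \<tau> k \<omega>)" "0 \<le> t"
  shows "{k. \<tau> k \<omega> \<le> t} = {..num_arrivals \<tau> t \<omega>}"
proof -
  let ?S = "{k. \<tau> k \<omega> \<le> t}"
  have fin: "finite ?S" using finite_arrivals_le[OF assms(1)] .
  have "0 \<in> ?S" using assms by (auto simp: arrival_path_def)
  hence ne: "?S \<noteq> {}" by blast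
  have N: "num_arrivals \<tau> t \<omega> = Max ?S"
    unfolding num_arrivals_def using cSup_eq_Max[OF fin ne] .
  have mono: "mono (\<lambda>k. \<tau> k \<omega>)"
    using assms(1) by (auto simp: arrival_path_def strict_mono_mono)
  have "\<tau> k \<omega> \<le> t" if "k \<le> Max ?S" for k
    using monoD[OF mono that] Max_in[OF fin ne] by auto
  moreover have "k \<le> Max ?S" if "\<tau> k \<omega> \<le> t" for k
    using Max_ge[OF fin] that by blast
  ultimately show ?thesis unfolding N by blast
qed

lemma walk_eq_sum_gap:
  assumes s: "arrival_path (\<lambda>k. \<tau> k \<omega>)" and t: "0 \<le> t" and K: "num_arrivals \<tau> t \<omega> < K"
  shows "walk \<tau> f t \<omega> = (\<Sum>k<K. gap (\<lambda>k. \<tau> k \<omega>) t k *\<^sub>R f k \<omega>)"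
proof -
  define N where "N = num_arrivals \<tau> t \<omega>"
  have S: "\<tau> k \<omega> \<le> t \<longleftrightarrow> k \<le> N" for k
    using arrivals_le_eq_atMost[of \<tau> \<omega>, OF s t] unfolding N_def by blast
  have "(\<Sum>k<K. gap (\<lambda>k. \<tau> k \<omega>) t k *\<^sub>R f k \<omega>) = (\<Sum>k<Suc N. gap (\<lambda>k. \<tau> k \<omega>) t k *\<^sub>R f k \<omega>)"
  proof (rule sum.mono_neutral_right)
    show "\<forall>k\<in>{..<K} - {..<Suc N}. gap (\<lambda>k. \<tau> k \<omega>) t k *\<^sub>R f k \<omega> = 0"
    proof
      fix k assume "k \<in> {..<K} - {..<Suc N}"
      hence "\<not> \<tau> k \<omega> \<le> t" "\<not> \<tau> (Suc k) \<omega> \<le> t" unfolding S by auto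
      thus "gap (\<lambda>k. \<tau> k \<omega>) t k *\<^sub>R f k \<omega> = 0" by (simp add: gap_def)
    qed
  qed (use K in \<open>auto simp: N_def\<close>)
  also have "\<dots> = (\<Sum>k<N. (\<tau> (Suc k) \<omega> - \<tau> k \<omega>) *\<^sub>R f k \<omega>) + (t - \<tau> N \<omega>) *\<^sub>R f N \<omega>"
  proof -
    have "gap (\<lambda>k. \<tau> k \<omega>) t k = \<tau> (Suc k) \<omega> - \<tau> k \<omega>" if "k < N" for k
      using that S[of k] S[of "Suc k"] by (simp add: gap_def)
    moreover have "gap (\<lambda>k. \<tau> k \<omega>) t N = t - \<tau> N \<omega>"
      using S[of N] S[of "Suc N"] by (simp add: gap_def)
    ultimately show ?thesis by simp
  qed
  finally show ?thesis by (simp add: walk_def N_def)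
qed

lemma gap_mono:
  assumes "s k \<le> s (Suc k)" "t \<le> u"
  shows "gap s t k \<le> gap s u k"
  using assms by (auto simp: gap_def min_def)

lemma sum_gap:
  "(\<Sum>k<K. gap s t k) = min (s K) t - min (s 0) t"
  unfolding gap_def by (rule sum_lessThan_telescope)

text \<open>Each clipped step length grows with time, and the growths telescope to the elapsed time.\<close>

lemma walk_coordinate_Lipschitz:
  assumes s: "arrival_path (\<lambda>k. \<tau> k \<omega>)" and t: "0 \<le> t" "t \<le> u"
    and f: "\<And>k. \<bar>f k \<omega> $ c\<bar> \<le> 1"
  shows "\<bar>walk \<tau> f u \<omega> $ c - walk \<tau> f t \<omega> $ c\<bar> \<le> u - t"
proof -
  let ?s = "\<lambda>k. \<tau> k \<omega>"
  define K where "K = Suc (max (num_arrivals \<tau> t \<omega>) (num_arrivals \<tau> u \<omega>))"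
  have u: "0 \<le> u" using t by simp
  have "K \<notin> {..num_arrivals \<tau> u \<omega>}" by (simp add: K_def)
  hence "\<not> ?s K \<le> u" unfolding arrivals_le_eq_atMost[of \<tau> \<omega>, OF s u, symmetric] by blast
  hence K: "u < ?s K" by simp
  have inc: "?s k \<le> ?s (Suc k)" for k
    using s by (auto simp: arrival_path_def strict_mono_Suc_iff less_imp_le)
  have "walk \<tau> f u \<omega> $ c - walk \<tau> f t \<omega> $ c = (\<Sum>k<K. (gap ?s u k - gap ?s t k) * (f k \<omega> $ c))"
    by (subst (1 2) walk_eq_sum_gap[of \<tau> \<omega>, OF s _, where K = K])
       (use t in \<open>auto simp: K_def sum_subtractf left_diff_distrib\<close>)
  also have "\<bar>\<dots>\<bar> \<le> (\<Sum>k<K. \<bar>(gap ?s u k - gap ?s t k) * (f k \<omega> $ c)\<bar>)"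
    by (rule sum_abs)
  also have "\<dots> \<le> (\<Sum>k<K. gap ?s u k - gap ?s t k)"
  proof (rule sum_mono)
    fix k
    have "\<bar>gap ?s u k - gap ?s t k\<bar> * \<bar>f k \<omega> $ c\<bar> \<le> \<bar>gap ?s u k - gap ?s t k\<bar> * 1"
      by (rule mult_left_mono[OF f]) simp
    thus "\<bar>(gap ?s u k - gap ?s t k) * (f k \<omega> $ c)\<bar> \<le> gap ?s u k - gap ?s t k"
      using gap_mono[of ?s k, OF inc t(2)] by (simp add: abs_mult)
  qed
  also have "\<dots> = u - t"
    using K t s by (simp add: sum_subtractf sum_gap arrival_path_def)
  finally show ?thesis .
qed

text \<open>Between a time and its integer part a coordinate changes by at most \<open>1\<close>, so only the
  countably many integer times and countably many boxes matter.\<close>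

lemma transient_path_if_integer_times:
  assumes s: "arrival_path (\<lambda>k. \<tau> k \<omega>)"
    and f: "\<And>k c. \<bar>f k \<omega> $ c\<bar> \<le> 1"
    and esc: "\<And>R :: nat. eventually (\<lambda>n :: nat.
      \<not> (\<bar>walk \<tau> f (real n) \<omega> $ i\<bar> \<le> R \<and> \<bar>walk \<tau> f (real n) \<omega> $ j\<bar> \<le> R)) sequentially"
  shows "transient_path (\<lambda>t. walk \<tau> f t \<omega>)"
  unfolding transient_path_def
proof (intro allI impI notI)
  fix \<rho> :: real assume "0 < \<rho>" and "recurrent_path \<rho> (\<lambda>t. walk \<tau> f t \<omega>)"
  then obtain v where v: "\<And>m. 0 \<le> v m" "filterlim v at_top sequentially"
    "\<And>m c. \<bar>walk \<tau> f (v m) \<omega> $ c\<bar> \<le> \<rho>"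
    by (auto simp: recurrent_path_def abs_le_iff) (metis minus_le_iff)
  \<comment> \<open>One more unit of room absorbs the change since the last integer time.\<close>
  define R where "R = nat \<lceil>\<rho> + 1\<rceil>"
  have R: "\<rho> + 1 \<le> real R" unfolding R_def by linarith
  obtain N where N: "\<And>n. n \<ge> N \<Longrightarrow>
      \<not> (\<bar>walk \<tau> f (real n) \<omega> $ i\<bar> \<le> R \<and> \<bar>walk \<tau> f (real n) \<omega> $ j\<bar> \<le> R)"
    using esc[of R] by (auto simp: eventually_sequentially)
  have "eventually (\<lambda>m. real N \<le> v m) sequentially"
    using v(2) by (auto simp: filterlim_at_top)
  then obtain m where m: "real N \<le> v m" by (auto simp: eventually_sequentially)
  define n where "n = nat \<lfloor>v m\<rfloor>"
  have n: "real n \<le> v m" "v m \<le> real n + 1" "N \<le> n"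
    using v(1)[of m] m unfolding n_def by linarith+
  have "\<bar>walk \<tau> f (real n) \<omega> $ c\<bar> \<le> R" for c
    using walk_coordinate_Lipschitz[of \<tau> \<omega> "real n" "v m" f c, OF s _ n(1) f]
      v(3)[of m c] n R by linarith
  thus False using N[OF n(3)] by blast
qed

text \<open>A path functional that is measurable on all pairs of sequences: the series has only finitely
  many nonzero terms on an arrival path, and elsewhere it is whatever \<open>suminf\<close> gives.\<close>

definition displacement :: "(nat \<Rightarrow> real) \<Rightarrow> (nat \<Rightarrow> real ^ 'd) \<Rightarrow> real \<Rightarrow> 'd \<Rightarrow> real" where
  "displacement s v t c = (\<Sum>k. gap s t k * v k $ c)"

lemma displacement_eq_sum:
  assumes "arrival_path s" "\<And>k. s k \<le> t \<Longrightarrow> k < K"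
  shows "displacement s v t c = (\<Sum>k<K. gap s t k * v k $ c)"
  unfolding displacement_def
proof (rule suminf_finite)
  fix k assume "k \<notin> {..<K}"
  hence "t < s k" using assms(2)[of k] by force
  moreover have "s k < s (Suc k)" using assms(1) by (simp add: arrival_path_def strict_mono_Suc_iff)
  ultimately show "gap s t k * v k $ c = 0" by (simp add: gap_def)
qed simp

lemma displacement_eq_walk:
  assumes "arrival_path (\<lambda>k. \<tau> k \<omega>)" "0 \<le> t"
  shows "displacement (\<lambda>k. \<tau> k \<omega>) (\<lambda>k. f k \<omega>) t c = walk \<tau> f t \<omega> $ c"
proof -
  have "k < Suc (num_arrivals \<tau> t \<omega>)" if "\<tau> k \<omega> \<le> t" for k
    using arrivals_le_eq_atMost[of \<tau> \<omega>, OF assms] that by (auto simp: less_Suc_eq_le)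
  from displacement_eq_sum[OF assms(1) this] show ?thesis
    using walk_eq_sum_gap[of \<tau> \<omega> t "Suc (num_arrivals \<tau> t \<omega>)" f, OF assms] by simp
qed

text \<open>A measurable version of the coordinate \<open>c\<close> of the walk; on arrival paths the two agree at
  all times \<open>t \<ge> 0\<close>.\<close>

definition walk_coordinate :: "(nat \<Rightarrow> 'w \<Rightarrow> real) \<Rightarrow> (nat \<Rightarrow> 'w \<Rightarrow> real ^ 'd) \<Rightarrow> real \<Rightarrow> 'd \<Rightarrow> 'w \<Rightarrow> real" where
  "walk_coordinate \<tau> f t c \<omega> = displacement (\<lambda>k. \<tau> k \<omega>) (\<lambda>k. f k \<omega>) t c"

section \<open>Steps of controlled length\<close>

definition cell :: "real \<Rightarrow> real \<Rightarrow> nat \<Rightarrow> real set" where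
  "cell a l q = {a + real q * l ..< a + real (Suc q) * l}"

lemma disjoint_cells:
  assumes "0 < l" "x \<in> cell a l p" "x \<in> cell a l q"
  shows "p = q"
proof -
  have *: False if "x \<in> cell a l p" "x \<in> cell a l q" "p < q" for p q
  proof -
    have "real (Suc p) * l \<le> real q * l"
      using that(3) assms(1) by (intro mult_right_mono) auto
    thus False using that(1,2) unfolding cell_def by auto
  qed
  show ?thesis using *[of p q] *[of q p] assms(2,3) by (meson linorder_neqE_nat)
qed

text \<open>A block consists of the three cells with indices \<open>3 * m\<close>, \<open>3 * m + 1\<close>, \<open>3 * m + 2\<close>. The
  empty middle cell forces a step of length at least one cell. The event is expressed by counts alone,
  so that its probability and the independence of blocks follow from those of Poisson counts.\<close>

definition separated :: "(nat \<Rightarrow> 'w \<Rightarrow> real) \<Rightarrow> real \<Rightarrow> real \<Rightarrow> nat \<Rightarrow> 'w \<Rightarrow> bool" where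
  "separated \<tau> a l m \<omega> \<longleftrightarrow> 0 < point_count \<tau> (cell a l (3 * m)) \<omega> \<and>
     point_count \<tau> (cell a l (3 * m + 1)) \<omega> = 0 \<and> 0 < point_count \<tau> (cell a l (3 * m + 2)) \<omega>"

text \<open>The step that leaves the last point of the first cell passes over the empty middle cell and
  ends in the third cell, since the third cell contains some point.\<close>

lemma gap_of_separated:
  assumes s: "arrival_path (\<lambda>k. \<tau> k \<omega>)" and l: "0 < l"
    and sep: "separated \<tau> a l m \<omega>" and t: "a + 3 * real (Suc m) * l \<le> t"
  obtains k where "\<tau> k \<omega> \<in> cell a l (3 * m)" "\<tau> (Suc k) \<omega> \<le> t"
    "l \<le> gap (\<lambda>k. \<tau> k \<omega>) t k" "gap (\<lambda>k. \<tau> k \<omega>) t k \<le> 3 * l"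
proof -
  let ?s = "\<lambda>k. \<tau> k \<omega>"
  define b where "b = a + real (3 * m) * l"
  have cells: "cell a l (3 * m) = {b ..< b + l}" "cell a l (3 * m + 1) = {b + l ..< b + 2 * l}"
    "cell a l (3 * m + 2) = {b + 2 * l ..< b + 3 * l}"
    unfolding cell_def b_def by (auto simp: algebra_simps)
  have t': "b + 3 * l \<le> t" using t by (simp add: b_def algebra_simps)
  have smono: "?s i < ?s j \<longleftrightarrow> i < j" for i j
    using strict_mono_less[of ?s] s by (simp add: arrival_path_def)
  from sep obtain p where p: "?s p \<in> {b ..< b + l}"
    unfolding separated_def cells point_count_def
    by (metis (mono_tags, lifting) card_gt_0_iff Collect_empty_eq)
  from sep obtain q where q: "?s q \<in> {b + 2 * l ..< b + 3 * l}"
    unfolding separated_def cells point_count_def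
    by (metis (mono_tags, lifting) card_gt_0_iff Collect_empty_eq)
  have fin: "finite {k. ?s k \<le> u}" for u using finite_arrivals_le[OF s] .
  have none: "\<not> (1 \<le> k \<and> ?s k \<in> {b + l ..< b + 2 * l})" for k
  proof -
    have "finite {k. 1 \<le> k \<and> ?s k \<in> {b + l ..< b + 2 * l}}"
      by (rule finite_subset[OF _ fin[of "b + 2 * l"]]) auto
    thus ?thesis using sep unfolding separated_def cells point_count_def by auto
  qed
  \<comment> \<open>Its maximum is the last point before the end of the first cell, and lies in that cell because some point does.\<close>
  define S where "S = {k. ?s k < b + l}"
  have finS: "finite S" unfolding S_def by (rule finite_subset[OF _ fin[of "b + l"]]) auto
  have pS: "p \<in> S" using p by (auto simp: S_def)
  define k where "k = Max S"
  have k: "?s k < b + l" using Max_in[OF finS] pS unfolding k_def S_def by blast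
  have "p \<le> k" using Max_ge[OF finS pS] by (simp add: k_def)
  hence k': "b \<le> ?s k" using p smono[of k p] by auto
  have "Suc k \<notin> S" using Max_ge[OF finS, of "Suc k"] by (auto simp: k_def)
  hence "b + 2 * l \<le> ?s (Suc k)" using none[of "Suc k"] by (auto simp: S_def)
  moreover have "?s (Suc k) < b + 3 * l"
  proof -
    have "k < q" using smono[of k q] k q l by auto
    hence "?s (Suc k) \<le> ?s q" using smono[of q "Suc k"] by auto
    thus ?thesis using q by auto
  qed
  ultimately show ?thesis
    using k k' t' l that[of k] by (auto simp: cells gap_def)
qed

text \<open>Different separated blocks give different steps, as these start in disjoint cells. All other
  factors are at most \<open>1\<close> and can be dropped.\<close>

lemma prod_gaps_le:
  fixes \<psi> :: "nat \<Rightarrow> real \<Rightarrow> real"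
  assumes s: "arrival_path (\<lambda>k. \<tau> k \<omega>)" and l: "0 < l" and \<delta>: "0 \<le> \<delta>" "\<delta> \<le> 1"
    and \<psi>: "\<And>k x. 0 \<le> \<psi> k x" "\<And>k x. \<psi> k x \<le> 1"
      "\<And>k x. l \<le> x \<Longrightarrow> x \<le> 3 * l \<Longrightarrow> \<psi> k x \<le> 1 - \<delta>"
    and t: "a + 3 * real B * l \<le> t" and K: "\<And>k. \<tau> k \<omega> \<le> t \<Longrightarrow> k < K"
  shows "(\<Prod>k<K. \<psi> k (gap (\<lambda>k. \<tau> k \<omega>) t k)) \<le>
    (\<Prod>m<B. 1 - \<delta> * of_bool (separated \<tau> a l m \<omega>))"
proof -
  let ?s = "\<lambda>k. \<tau> k \<omega>"
  define G where "G = {m. m < B \<and> separated \<tau> a l m \<omega>}"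
  have "\<exists>k. ?s k \<in> cell a l (3 * m) \<and> ?s (Suc k) \<le> t \<and> l \<le> gap ?s t k \<and> gap ?s t k \<le> 3 * l"
    if "m \<in> G" for m
  proof -
    have "3 * real (Suc m) * l \<le> 3 * real B * l"
      using that l by (intro mult_right_mono) (auto simp: G_def)
    hence "a + 3 * real (Suc m) * l \<le> t" using t by simp
    thus ?thesis
      using gap_of_separated[of \<tau> \<omega> l a m t, OF s l] that by (metis (no_types, lifting) G_def mem_Collect_eq)
  qed
  then obtain \<kappa> where \<kappa>: "\<And>m. m \<in> G \<Longrightarrow> ?s (\<kappa> m) \<in> cell a l (3 * m)"
    "\<And>m. m \<in> G \<Longrightarrow> ?s (Suc (\<kappa> m)) \<le> t"
    "\<And>m. m \<in> G \<Longrightarrow> l \<le> gap ?s t (\<kappa> m)" "\<And>m. m \<in> G \<Longrightarrow> gap ?s t (\<kappa> m) \<le> 3 * l"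
    by metis
  \<comment> \<open>The step chosen for a block starts in the first cell of that block.\<close>
  have inj: "inj_on \<kappa> G"
  proof (rule inj_onI)
    fix m m' assume "m \<in> G" "m' \<in> G" "\<kappa> m = \<kappa> m'"
    thus "m = m'" using disjoint_cells[OF l, of "?s (\<kappa> m)" a "3 * m" "3 * m'"] \<kappa>(1) by force
  qed
  have sub: "\<kappa> ` G \<subseteq> {..<K}" using \<kappa>(2)[THEN K] by (auto intro: Suc_lessD)
  have "(\<Prod>k<K. \<psi> k (gap ?s t k)) =
      (\<Prod>k\<in>\<kappa> ` G. \<psi> k (gap ?s t k)) * (\<Prod>k\<in>{..<K} - \<kappa> ` G. \<psi> k (gap ?s t k))"
    using sub by (subst prod.subset_diff[OF sub]) (auto simp: mult.commute)
  also have "\<dots> \<le> (\<Prod>k\<in>\<kappa> ` G. \<psi> k (gap ?s t k))"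
    by (rule mult_left_le[OF prod_le_1 prod_nonneg]) (auto simp: \<psi>)
  also have "\<dots> = (\<Prod>m\<in>G. \<psi> (\<kappa> m) (gap ?s t (\<kappa> m)))"
    using inj by (simp add: prod.reindex)
  also have "\<dots> \<le> (\<Prod>m\<in>G. 1 - \<delta>)"
    by (intro prod_mono) (auto simp: \<psi> \<kappa>)
  also have "\<dots> = (\<Prod>m<B. 1 - \<delta> * of_bool (separated \<tau> a l m \<omega>))"
    by (rule prod.mono_neutral_cong_left) (auto simp: G_def)
  finally show ?thesis .
qed

section \<open>Poisson counts in cells\<close>

context poisson_points
begin

lemma point_count_measurable [measurable]:
  assumes "A \<in> sets borel" "bounded A" "A \<subseteq> {0..}"
  shows "point_count \<tau> A \<in> measurable M (count_space UNIV)"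
  using count_indep[of 1 "\<lambda>_. A"] assms
  by (auto simp: indep_vars_def disjoint_family_on_def)

lemma prob_no_point:
  assumes "A \<in> sets borel" "bounded A" "A \<subseteq> {0..}"
  shows "prob {\<omega> \<in> space M. point_count \<tau> A \<omega> = 0} = exp (- (LINT t:A|lborel. rate t))"
  using count_poisson[OF assms, of 0] by simp

lemma prob_some_point:
  assumes A: "A \<in> sets borel" "bounded A" "A \<subseteq> {0..}"
  shows "prob {\<omega> \<in> space M. 0 < point_count \<tau> A \<omega>} = 1 - exp (- (LINT t:A|lborel. rate t))"
proof -
  note [measurable] = point_count_measurable[OF A]
  have "prob {\<omega> \<in> space M. \<not> (point_count \<tau> A \<omega> = 0)} = 1 - prob {\<omega> \<in> space M. point_count \<tau> A \<omega> = 0}"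
    by (rule prob_neg) measurable
  thus ?thesis using prob_no_point[OF A] by simp
qed

lemma cell_borel_bounded_nonneg:
  assumes "0 \<le> a" "0 < l"
  shows "cell a l q \<in> sets borel" "bounded (cell a l q)" "cell a l q \<subseteq> {0..}"
proof -
  have "0 \<le> a + real q * l" using assms by simp
  thus "cell a l q \<subseteq> {0..}" by (auto simp: cell_def)
qed (simp_all add: cell_def)

lemma indep_cell_counts:
  assumes "0 \<le> a" "0 < l"
  shows "indep_vars (\<lambda>_. count_space UNIV) (\<lambda>q. point_count \<tau> (cell a l q)) {..<n}"
proof (rule count_indep)
  show "disjoint_family_on (cell a l) {..<n}"
    using disjoint_cells[OF assms(2)] by (auto simp: disjoint_family_on_def)
qed (use cell_borel_bounded_nonneg[OF assms] in auto)

lemma cell_rate_bounds: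
  assumes "0 \<le> a" "0 < l"
    and r: "\<And>t. t \<in> cell a l q \<Longrightarrow> r \<le> rate t" and R: "\<And>t. t \<in> cell a l q \<Longrightarrow> rate t \<le> R"
  shows "r * l \<le> (LINT t:cell a l q|lborel. rate t)" "(LINT t:cell a l q|lborel. rate t) \<le> R * l"
proof -
  define T where "T = a + real (Suc q) * l"
  have T: "0 \<le> T" using assms(1,2) by (simp add: T_def)
  have "set_integrable lborel {0..T} rate" using rate T by (simp add: rate_function_def)
  hence int: "set_integrable lborel (cell a l q) rate"
    by (rule set_integrable_subset)
       (use cell_borel_bounded_nonneg[OF assms(1,2), of q] in \<open>auto simp: T_def cell_def\<close>)
  have len: "measure lborel (cell a l q) = l"
    using assms(2) by (simp add: cell_def algebra_simps)
  have fin: "emeasure lborel (cell a l q) < \<infinity>" by (rule emeasure_bounded_finite) (rule cell_borel_bounded_nonneg[OF assms(1,2)])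
  have const: "set_integrable lborel (cell a l q) (\<lambda>_. c)"
      "(LINT t:cell a l q|lborel. c) = c * l" for c :: real
    using fin cell_borel_bounded_nonneg[OF assms(1,2), of q] len
    by (auto simp: set_integrable_def set_lebesgue_integral_def)
  show "r * l \<le> (LINT t:cell a l q|lborel. rate t)"
    unfolding const(2)[symmetric] by (rule set_integral_mono[OF const(1) int r])
  show "(LINT t:cell a l q|lborel. rate t) \<le> R * l"
    unfolding const(2)[symmetric] by (rule set_integral_mono[OF int const(1) R])
qed

text \<open>The blocks use disjoint groups of the independent cell counts.\<close>

lemma indep_separated:
  assumes "0 \<le> a" "0 < l"
  shows "indep_vars (\<lambda>_. count_space UNIV) (separated \<tau> a l) {..<B}"
proof -
  let ?X = "\<lambda>q. point_count \<tau> (cell a l q)"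
  let ?J = "\<lambda>m. {3 * m, 3 * m + 1, 3 * m + 2 :: nat}"
  let ?P = "\<lambda>m (x :: nat \<Rightarrow> nat). 0 < x (3 * m) \<and> x (3 * m + 1) = 0 \<and> 0 < x (3 * m + 2)"
  have "disjoint_family_on ?J {..<B}" unfolding disjoint_family_on_def by (auto; presburger)
  hence "indep_vars (\<lambda>m. PiM (?J m) (\<lambda>_. count_space UNIV)) (\<lambda>m \<omega>. restrict (\<lambda>q. ?X q \<omega>) (?J m)) {..<B}"
    by (intro indep_vars_restrict[OF indep_cell_counts[OF assms, of "3 * B"]]) auto
  hence "indep_vars (\<lambda>_. count_space UNIV) (\<lambda>m \<omega>. ?P m (restrict (\<lambda>q. ?X q \<omega>) (?J m))) {..<B}"
  proof (rule indep_vars_compose2)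
    fix m :: nat
    have [measurable]: "(\<lambda>x. x q) \<in> measurable (PiM (?J m) (\<lambda>_. count_space (UNIV :: nat set))) (count_space UNIV)"
      if "q \<in> ?J m" for q
      using that by (rule measurable_component_singleton)
    show "?P m \<in> measurable (PiM (?J m) (\<lambda>_. count_space UNIV)) (count_space UNIV)"
      by measurable
  qed
  thus ?thesis by (simp add: separated_def[abs_def])
qed

lemma prob_separated_ge:
  assumes al: "0 \<le> a" "0 < l" and r0: "0 \<le> r"
    and r: "\<And>t. a \<le> t \<Longrightarrow> t < a + 3 * real (Suc m) * l \<Longrightarrow> r \<le> rate t"
    and R: "\<And>t. a \<le> t \<Longrightarrow> t < a + 3 * real (Suc m) * l \<Longrightarrow> rate t \<le> R"
  shows "(1 - exp (- (r * l)))\<^sup>2 * exp (- (R * l)) \<le> prob {\<omega> \<in> space M. separated \<tau> a l m \<omega>}"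
proof -
  let ?X = "\<lambda>q. point_count \<tau> (cell a l q)"
  let ?J = "{3 * m, 3 * m + 1, 3 * m + 2 :: nat}"
  let ?A = "\<lambda>q. if q = 3 * m + 1 then {0} else {0 :: nat<..}"
  let ?L = "\<lambda>q. LINT t:cell a l q|lborel. rate t"
  have sub: "a \<le> t \<and> t < a + 3 * real (Suc m) * l" if "q \<in> ?J" "t \<in> cell a l q" for q t
  proof -
    have "real (Suc q) * l \<le> 3 * real (Suc m) * l" "0 \<le> real q * l"
      using that(1) al by (auto intro!: mult_right_mono)
    thus ?thesis using that(2) by (auto simp: cell_def)
  qed
  have L: "r * l \<le> ?L q" "?L q \<le> R * l" if "q \<in> ?J" for q
    using cell_rate_bounds[OF al, of q r R] r R sub[OF that] by blast+
  have "prob (\<Inter>q\<in>?J. ?X q -` ?A q \<inter> space M) = (\<Prod>q\<in>?J. prob (?X q -` ?A q \<inter> space M))"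
    by (rule indep_varsD[OF indep_cell_counts[OF al, of "3 * m + 3"]]) auto
  also have "(\<Inter>q\<in>?J. ?X q -` ?A q \<inter> space M) = {\<omega> \<in> space M. separated \<tau> a l m \<omega>}"
    by (auto simp: separated_def)
  also have "(\<Prod>q\<in>?J. prob (?X q -` ?A q \<inter> space M)) =
      prob {\<omega> \<in> space M. 0 < ?X (3 * m) \<omega>} * prob {\<omega> \<in> space M. ?X (3 * m + 1) \<omega> = 0} *
      prob {\<omega> \<in> space M. 0 < ?X (3 * m + 2) \<omega>}"
    by (simp add: vimage_def Int_def conj_commute)
  also have "\<dots> = (1 - exp (- ?L (3 * m))) * exp (- ?L (3 * m + 1)) * (1 - exp (- ?L (3 * m + 2)))"
    using cell_borel_bounded_nonneg[OF al] by (simp add: prob_some_point prob_no_point)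
  finally have eq: "prob {\<omega> \<in> space M. separated \<tau> a l m \<omega>} = \<dots>" .
  have "0 \<le> r * l" using r0 al by simp
  hence "(1 - exp (- (r * l))) * exp (- (R * l)) * (1 - exp (- (r * l))) \<le>
      (1 - exp (- ?L (3 * m))) * exp (- ?L (3 * m + 1)) * (1 - exp (- ?L (3 * m + 2)))"
    using L(1)[of "3 * m"] L(1)[of "3 * m + 2"] L(2)[of "3 * m + 1"]
    by (intro mult_mono mult_nonneg_nonneg) auto
  thus ?thesis unfolding eq by (simp add: power2_eq_square mult_ac)
qed

text \<open>By independence the expectation is a product of factors \<open>1 - \<delta> * p\<close>, and
  \<open>1 - x \<le> exp (- x)\<close>.\<close>

lemma expectation_prod_separated_le:
  assumes al: "0 \<le> a" "0 < l" and r0: "0 \<le> r" and \<delta>: "0 \<le> \<delta>" "\<delta> \<le> 1"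
    and r: "\<And>t. a \<le> t \<Longrightarrow> t < a + 3 * real B * l \<Longrightarrow> r \<le> rate t"
    and R: "\<And>t. a \<le> t \<Longrightarrow> t < a + 3 * real B * l \<Longrightarrow> rate t \<le> R"
  shows "expectation (\<lambda>\<omega>. \<Prod>m<B. 1 - \<delta> * of_bool (separated \<tau> a l m \<omega>)) \<le>
    exp (- (real B * \<delta> * ((1 - exp (- (r * l)))\<^sup>2 * exp (- (R * l)))))"
proof -
  let ?p = "(1 - exp (- (r * l)))\<^sup>2 * exp (- (R * l))"
  have rv: "separated \<tau> a l m \<in> measurable M (count_space UNIV)" for m
    using indep_separated[OF al, of "Suc m"] by (auto simp: indep_vars_def)
  note [measurable] = rv
  have indep: "indep_vars (\<lambda>_. borel) (\<lambda>m \<omega>. 1 - \<delta> * of_bool (separated \<tau> a l m \<omega>)) {..<B}"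
    by (rule indep_vars_compose2[OF indep_separated[OF al]]) simp
  have bound: "\<bar>1 - \<delta> * of_bool b\<bar> \<le> 1" for b using \<delta> by (cases b) auto
  have "expectation (\<lambda>\<omega>. \<Prod>m<B. 1 - \<delta> * of_bool (separated \<tau> a l m \<omega>)) =
      (\<Prod>m<B. expectation (\<lambda>\<omega>. 1 - \<delta> * of_bool (separated \<tau> a l m \<omega>)))"
    by (rule indep_vars_lebesgue_integral[OF _ indep])
       (auto intro!: integrable_const_bound[of _ 1] simp: bound)
  also have "\<dots> \<le> (\<Prod>m<B. exp (- (\<delta> * ?p)))"
  proof (rule prod_mono, intro conjI)
    fix m assume m: "m \<in> {..<B}"
    have "3 * real (Suc m) * l \<le> 3 * real B * l"
      using m al by (intro mult_right_mono) auto
    hence p: "?p \<le> prob {\<omega> \<in> space M. separated \<tau> a l m \<omega>}"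
      by (intro prob_separated_ge[OF al r0] r R) auto
    have "expectation (\<lambda>\<omega>. of_bool (separated \<tau> a l m \<omega>)) = prob {\<omega> \<in> space M. separated \<tau> a l m \<omega>}"
    proof -
      have "expectation (\<lambda>\<omega>. of_bool (separated \<tau> a l m \<omega>) :: real) =
          expectation (indicator {\<omega> \<in> space M. separated \<tau> a l m \<omega>})"
        by (intro Bochner_Integration.integral_cong) (auto simp: indicator_def)
      thus ?thesis by simp
    qed
    moreover have "integrable M (\<lambda>\<omega>. of_bool (separated \<tau> a l m \<omega>) :: real)"
      by (rule integrable_const_bound[of _ 1]) auto
    ultimately have E: "expectation (\<lambda>\<omega>. 1 - \<delta> * of_bool (separated \<tau> a l m \<omega>)) =
        1 - \<delta> * prob {\<omega> \<in> space M. separated \<tau> a l m \<omega>}"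
      by (simp add: prob_space)
    have "\<delta> * prob {\<omega> \<in> space M. separated \<tau> a l m \<omega>} \<le> 1"
      using mult_mono[OF \<delta>(2) prob_le_1] by simp
    thus "0 \<le> expectation (\<lambda>\<omega>. 1 - \<delta> * of_bool (separated \<tau> a l m \<omega>))" unfolding E by simp
    have "1 - \<delta> * prob {\<omega> \<in> space M. separated \<tau> a l m \<omega>} \<le> 1 - \<delta> * ?p"
      using mult_left_mono[OF p \<delta>(1)] by simp
    also have "\<dots> \<le> exp (- (\<delta> * ?p))" using exp_ge_add_one_self[of "- (\<delta> * ?p)"] by simp
    finally show "expectation (\<lambda>\<omega>. 1 - \<delta> * of_bool (separated \<tau> a l m \<omega>)) \<le> exp (- (\<delta> * ?p))"
      unfolding E .
  qed
  also have "\<dots> = exp (- (real B * \<delta> * ?p))"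
    by (simp add: exp_of_nat_mult[symmetric] mult_ac)
  finally show ?thesis .
qed

end

section \<open>Small-ball probabilities by Gaussian averaging\<close>

text \<open>The factor \<open>exp (R\<^sup>2)\<close> dominates \<open>exp (X\<^sup>2 / 2 + Y\<^sup>2 / 2)\<close> on the event, and
  \<open>exp (- x\<^sup>2 / 2)\<close> is the standard normal average of \<open>exp (\<i> g x)\<close>. Exchanging the averages with
  the expectation brings in the joint characteristic function of \<open>X\<close> and \<open>Y\<close>.\<close>

lemma (in prob_space) small_ball_le_gaussian_average:
  assumes X[measurable]: "X \<in> borel_measurable M" and Y[measurable]: "Y \<in> borel_measurable M"
    and H[measurable]: "H \<in> borel_measurable borel"
    and int: "integrable std_normal_distribution H"
    and char_le: "\<And>g h. norm (\<integral>\<omega>. iexp (g * X \<omega> + h * Y \<omega>) \<partial>M) \<le> H g * H h"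
  shows "prob {\<omega> \<in> space M. \<bar>X \<omega>\<bar> \<le> R \<and> \<bar>Y \<omega>\<bar> \<le> R} \<le>
    exp (R\<^sup>2) * (\<integral>g. H g \<partial>std_normal_distribution)\<^sup>2"
proof -
  let ?N = std_normal_distribution
  interpret N: real_distribution ?N by (rule real_dist_normal_dist)
  interpret NN: pair_prob_space ?N ?N ..
  interpret MN: pair_prob_space M "?N \<Otimes>\<^sub>M ?N" ..
  let ?E = "\<lambda>\<omega> z. iexp (fst z * X \<omega> + snd z * Y \<omega>) :: complex"
  have char1: "(\<integral>g. iexp (g * x) \<partial>?N) = exp (- x\<^sup>2 / 2)" for x :: real
    using fun_cong[OF char_std_normal_distribution, of x] by (simp add: char_def mult.commute)
  have char2: "(\<integral>z. ?E \<omega> z \<partial>(?N \<Otimes>\<^sub>M ?N)) = exp (- (X \<omega>)\<^sup>2 / 2) * exp (- (Y \<omega>)\<^sup>2 / 2)" for \<omega>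
  proof -
    have "integrable (?N \<Otimes>\<^sub>M ?N) (?E \<omega>)"
      by (rule NN.integrable_const_bound[of _ 1]) simp_all
    from NN.integral_fst'[OF this] have "(\<integral>z. ?E \<omega> z \<partial>(?N \<Otimes>\<^sub>M ?N)) =
        (\<integral>g. (\<integral>h. iexp (g * X \<omega>) * iexp (h * Y \<omega>) \<partial>?N) \<partial>?N)"
      by (simp add: exp_add distrib_left)
    also have "\<dots> = (\<integral>g. iexp (g * X \<omega>) \<partial>?N) * (\<integral>h. iexp (h * Y \<omega>) \<partial>?N)" by simp
    finally show ?thesis unfolding char1 by simp
  qed
  have int3: "integrable (M \<Otimes>\<^sub>M (?N \<Otimes>\<^sub>M ?N)) (\<lambda>(\<omega>, z). ?E \<omega> z)"
    by (rule MN.integrable_const_bound[of _ 1]) (simp_all add: split_beta)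
  have HH: "integrable (?N \<Otimes>\<^sub>M ?N) (\<lambda>z. H (fst z) * H (snd z))"
  proof (rule NN.Fubini_integrable)
    show "integrable ?N (\<lambda>x. \<integral>y. norm (H (fst (x, y)) * H (snd (x, y))) \<partial>?N)"
      using int by (simp add: abs_mult)
    show "AE x in ?N. integrable ?N (\<lambda>y. H (fst (x, y)) * H (snd (x, y)))"
      using int by simp
  qed measurable
  have "prob {\<omega> \<in> space M. \<bar>X \<omega>\<bar> \<le> R \<and> \<bar>Y \<omega>\<bar> \<le> R} =
      (\<integral>\<omega>. indicator {\<omega> \<in> space M. \<bar>X \<omega>\<bar> \<le> R \<and> \<bar>Y \<omega>\<bar> \<le> R} \<omega> \<partial>M)" by simp
  also have "\<dots> \<le> (\<integral>\<omega>. exp (R\<^sup>2) * (exp (- (X \<omega>)\<^sup>2 / 2) * exp (- (Y \<omega>)\<^sup>2 / 2)) \<partial>M)"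
  proof (rule integral_mono)
    show "integrable M (\<lambda>\<omega>. exp (R\<^sup>2) * (exp (- (X \<omega>)\<^sup>2 / 2) * exp (- (Y \<omega>)\<^sup>2 / 2)))"
      by (intro integrable_mult_right integrable_const_bound[of _ 1])
         (simp_all add: mult_exp_exp)
    fix \<omega> assume "\<omega> \<in> space M"
    have "0 \<le> R\<^sup>2 - (X \<omega>)\<^sup>2 / 2 - (Y \<omega>)\<^sup>2 / 2" if "\<bar>X \<omega>\<bar> \<le> R" "\<bar>Y \<omega>\<bar> \<le> R"
      using that[THEN abs_le_square_iff[THEN iffD1, OF order.trans[OF _ abs_ge_self]]] by simp
    thus "indicator {\<omega> \<in> space M. \<bar>X \<omega>\<bar> \<le> R \<and> \<bar>Y \<omega>\<bar> \<le> R} \<omega> \<le>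
        exp (R\<^sup>2) * (exp (- (X \<omega>)\<^sup>2 / 2) * exp (- (Y \<omega>)\<^sup>2 / 2))"
      by (auto simp: indicator_def mult_exp_exp)
  qed (auto intro!: integrable_const_bound[of _ 1])
  also have "\<dots> = exp (R\<^sup>2) * Re (\<integral>\<omega>. (\<integral>z. ?E \<omega> z \<partial>(?N \<Otimes>\<^sub>M ?N)) \<partial>M)"
    unfolding char2 by (simp flip: of_real_mult)
  also have "(\<integral>\<omega>. (\<integral>z. ?E \<omega> z \<partial>(?N \<Otimes>\<^sub>M ?N)) \<partial>M) =
      (\<integral>z. (\<integral>\<omega>. ?E \<omega> z \<partial>M) \<partial>(?N \<Otimes>\<^sub>M ?N))"
    using MN.Fubini_integral[OF int3] by simp
  also have "Re \<dots> \<le> norm \<dots>" by (rule complex_Re_le_cmod)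
  also have "\<dots> \<le> (\<integral>z. norm (\<integral>\<omega>. ?E \<omega> z \<partial>M) \<partial>(?N \<Otimes>\<^sub>M ?N))" by (rule integral_norm_bound)
  also have "\<dots> \<le> (\<integral>z. H (fst z) * H (snd z) \<partial>(?N \<Otimes>\<^sub>M ?N))"
  proof (rule integral_mono[OF _ HH])
    show "integrable (?N \<Otimes>\<^sub>M ?N) (\<lambda>z. norm (\<integral>\<omega>. ?E \<omega> z \<partial>M))"
      using MN.integrable_snd[OF int3] by simp
    show "norm (\<integral>\<omega>. ?E \<omega> z \<partial>M) \<le> H (fst z) * H (snd z)" for z
      by (rule char_le)
  qed
  also have "\<dots> = (\<integral>g. H g \<partial>?N)\<^sup>2"
    using NN.integral_fst'[OF HH] by (simp add: power2_eq_square)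
  finally show ?thesis by simp
qed

text \<open>Up to the factor \<open>\<sigma>\<close>, the product of the Gaussian weight and the standard normal density is
  the centred normal density of variance \<open>1 / (1 + 2 * a)\<close>.\<close>

lemma integral_exp_quadratic_std_normal:
  assumes a: "0 \<le> a"
  shows "integrable std_normal_distribution (\<lambda>g. exp (- a * g\<^sup>2))"
    and "(\<integral>g. exp (- a * g\<^sup>2) \<partial>std_normal_distribution) = 1 / sqrt (1 + 2 * a)"
proof -
  define \<sigma> where "\<sigma> = 1 / sqrt (1 + 2 * a)"
  have \<sigma>: "0 < \<sigma>" "\<sigma>\<^sup>2 = 1 / (1 + 2 * a)" using a by (auto simp: \<sigma>_def power_divide)
  have eq: "std_normal_density g * exp (- a * g\<^sup>2) = \<sigma> * normal_density 0 \<sigma> g" for g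
  proof -
    have "- g\<^sup>2 / (2 * \<sigma>\<^sup>2) = - g\<^sup>2 / 2 + - a * g\<^sup>2" unfolding \<sigma>(2) by (simp add: field_simps)
    moreover have "sqrt (2 * pi * \<sigma>\<^sup>2) = sqrt (2 * pi) * \<sigma>" using \<sigma>(1) by (simp add: real_sqrt_mult)
    ultimately show ?thesis using \<sigma>(1) by (simp add: normal_density_def mult_exp_exp)
  qed
  have "integrable lborel (\<lambda>g. std_normal_density g * exp (- a * g\<^sup>2))"
    unfolding eq using \<sigma> by simp
  thus "integrable std_normal_distribution (\<lambda>g. exp (- a * g\<^sup>2))"
    by (subst integrable_density) simp_all
  have "(\<integral>g. exp (- a * g\<^sup>2) \<partial>std_normal_distribution) = (\<integral>g. std_normal_density g * exp (- a * g\<^sup>2) \<partial>lborel)"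
    by (subst integral_density) simp_all
  also have "\<dots> = \<sigma>" unfolding eq using \<sigma> by simp
  finally show "(\<integral>g. exp (- a * g\<^sup>2) \<partial>std_normal_distribution) = 1 / sqrt (1 + 2 * a)"
    by (simp add: \<sigma>_def)
qed

lemma integral_abs_std_normal:
  shows "integrable std_normal_distribution (\<lambda>g. \<bar>g\<bar>)"
    and "(\<integral>g. \<bar>g\<bar> \<partial>std_normal_distribution) \<le> 1"
proof -
  show "integrable std_normal_distribution (\<lambda>g. \<bar>g\<bar>)"
    using integrable_abs[OF integrable_std_normal_distribution_moment[of 1]] by simp
  have "(\<integral>g. \<bar>g\<bar> \<partial>std_normal_distribution) = sqrt (2 / pi)"
    using std_normal_distribution_odd_moments_abs[of 0] by simp
  also have "\<dots> \<le> 1" using pi_gt3 by (simp add: field_simps)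
  finally show "(\<integral>g. \<bar>g\<bar> \<partial>std_normal_distribution) \<le> 1" .
qed

section \<open>The characteristic function of the walk\<close>

text \<open>Fubini for two independent random variables with values in different spaces: one of them may
  be frozen while the expectation over the other is taken.\<close>

lemma (in prob_space) integral_indep_pair:
  fixes h :: "'b \<times> 'c \<Rightarrow> complex"
  assumes T[measurable]: "T \<in> M \<rightarrow>\<^sub>M N1" and F[measurable]: "F \<in> M \<rightarrow>\<^sub>M N2"
    and indep: "indep_set {T -` A \<inter> space M | A. A \<in> sets N1} {F -` B \<inter> space M | B. B \<in> sets N2}"
    and h[measurable]: "h \<in> borel_measurable (N1 \<Otimes>\<^sub>M N2)" and bounded: "\<And>x. norm (h x) \<le> 1"
  shows "(\<integral>\<omega>. h (T \<omega>, F \<omega>) \<partial>M) = (\<integral>\<omega>'. (\<integral>\<omega>. h (T \<omega>', F \<omega>) \<partial>M) \<partial>M)"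
proof -
  let ?P = "distr M N1 T" and ?Q = "distr M N2 F"
  interpret P: prob_space ?P by (rule prob_space_distr) fact
  interpret Q: prob_space ?Q by (rule prob_space_distr) fact
  interpret PQ: pair_prob_space ?P ?Q ..
  \<comment> \<open>Independence of the preimages is exactly that the joint law is the product law.\<close>
  have eq: "?P \<Otimes>\<^sub>M ?Q = distr M (N1 \<Otimes>\<^sub>M N2) (\<lambda>\<omega>. (T \<omega>, F \<omega>))"
  proof (rule pair_measure_eqI)
    fix A B assume AB: "A \<in> sets ?P" "B \<in> sets ?Q"
    hence [measurable]: "A \<in> sets N1" "B \<in> sets N2" by simp_all
    have "prob ((T -` A \<inter> space M) \<inter> (F -` B \<inter> space M)) =
        prob (T -` A \<inter> space M) * prob (F -` B \<inter> space M)"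
      using indep_setD[OF indep] \<open>A \<in> sets N1\<close> \<open>B \<in> sets N2\<close> by blast
    moreover have "(\<lambda>\<omega>. (T \<omega>, F \<omega>)) -` (A \<times> B) \<inter> space M =
        (T -` A \<inter> space M) \<inter> (F -` B \<inter> space M)" by auto
    ultimately show "emeasure ?P A * emeasure ?Q B =
        emeasure (distr M (N1 \<Otimes>\<^sub>M N2) (\<lambda>\<omega>. (T \<omega>, F \<omega>))) (A \<times> B)"
      by (simp add: emeasure_distr emeasure_eq_measure ennreal_mult)
  qed (simp_all add: P.sigma_finite_measure_axioms Q.sigma_finite_measure_axioms)
  have int: "integrable (?P \<Otimes>\<^sub>M ?Q) h"
    by (rule PQ.integrable_const_bound[of _ 1]) (simp_all add: bounded)
  have "(\<integral>\<omega>. h (T \<omega>, F \<omega>) \<partial>M) = (\<integral>x. h x \<partial>(?P \<Otimes>\<^sub>M ?Q))"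
    unfolding eq by (subst integral_distr) simp_all
  also have "\<dots> = (\<integral>x. (\<integral>y. h (x, y) \<partial>?Q) \<partial>?P)"
    using PQ.integral_fst'[OF int] by simp
  also have "\<dots> = (\<integral>\<omega>'. (\<integral>\<omega>. h (T \<omega>', F \<omega>) \<partial>M) \<partial>M)"
  proof -
    have "(\<integral>y. h (x, y) \<partial>?Q) = (\<integral>\<omega>. h (x, F \<omega>) \<partial>M)" if "x \<in> space N1" for x
      using that by (subst integral_distr) simp_all
    hence "(\<integral>x. (\<integral>y. h (x, y) \<partial>?Q) \<partial>?P) = (\<integral>x. (\<integral>\<omega>. h (x, F \<omega>) \<partial>M) \<partial>?P)"
      by (intro Bochner_Integration.integral_cong) simp_all
    also have "\<dots> = (\<integral>\<omega>'. (\<integral>\<omega>. h (T \<omega>', F \<omega>) \<partial>M) \<partial>M)"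
      by (rule integral_distr) measurable
    finally show ?thesis .
  qed
  finally show ?thesis .
qed

lemma borel_measurable_vec_nth [measurable (raw)]:
  fixes X :: "'a \<Rightarrow> real ^ 'd"
  assumes "X \<in> borel_measurable M"
  shows "(\<lambda>x. X x $ i) \<in> borel_measurable M"
  using borel_measurable_inner[OF assms borel_measurable_const, of "axis i 1"]
  by (simp add: inner_axis)

lemma signed_axes_finite_card:
  "finite (signed_axes :: (real ^ 'd) set)" "card (signed_axes :: (real ^ 'd) set) = 2 * CARD('d)"
proof -
  let ?P = "range (\<lambda>j :: 'd. axis j (1 :: real))" and ?N = "range (\<lambda>j :: 'd. axis j (- 1 :: real))"
  have neg: "- axis j 1 = axis j (- 1 :: real)" for j :: 'd by (auto simp: vec_eq_iff axis_def)
  have eq: "signed_axes = ?P \<union> ?N" unfolding signed_axes_def neg by auto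
  have "inj (\<lambda>j :: 'd. axis j (1 :: real))" "inj (\<lambda>j :: 'd. axis j (- 1 :: real))"
    by (auto simp: inj_def axis_eq_axis)
  moreover have "?P \<inter> ?N = {}" by (auto simp: axis_eq_axis)
  ultimately show "card (signed_axes :: (real ^ 'd) set) = 2 * CARD('d)"
    unfolding eq by (subst card_Un_disjoint) (simp_all add: card_image)
  show "finite (signed_axes :: (real ^ 'd) set)" unfolding eq by simp
qed

lemma cos_le_quadratic:
  fixes y :: real
  assumes "\<bar>y\<bar> \<le> 1"
  shows "cos y \<le> 1 - y\<^sup>2 / 4" "0 \<le> cos y"
proof -
  have half: "1 / 2 \<le> cos t" if "0 \<le> t" "t \<le> 1" for t :: real
    using cos_monotone_0_pi_le[of t "pi / 3"] that pi_gt3 by (simp add: cos_60)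
  show "0 \<le> cos y" using half[of "\<bar>y\<bar>"] assms by simp
  show "cos y \<le> 1 - y\<^sup>2 / 4"
  proof (cases "y = 0")
    case False
    then obtain t where t: "0 < t" "t < \<bar>y\<bar>"
      "cos \<bar>y\<bar> = (\<Sum>m<2. cos_coeff m * \<bar>y\<bar> ^ m) + cos (t + 1 / 2 * real 2 * pi) / fact 2 * \<bar>y\<bar> ^ 2"
      using Maclaurin_cos_expansion2[of "\<bar>y\<bar>" 2] by auto
    hence "cos y = 1 - cos t / 2 * y\<^sup>2"
      by (simp add: cos_coeff_def numeral_2_eq_2 fact_numeral)
    moreover have "1 / 2 / 2 * y\<^sup>2 \<le> cos t / 2 * y\<^sup>2"
      using half[of t] t assms by (intro mult_right_mono divide_right_mono) auto
    ultimately show ?thesis by simp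
  qed simp
qed

context orthogonal_conservative_walk
begin

lemma direction_measurable [measurable]: "f k \<in> borel_measurable M"
  using directions_indep by (auto simp: indep_vars_def)

lemma directions_in_signed_axes: "AE \<omega> in M. \<forall>k. f k \<omega> \<in> signed_axes"
  unfolding AE_all_countable
proof
  fix k
  let ?A = "\<lambda>v. {\<omega> \<in> space M. f k \<omega> = v}"
  have "prob (\<Union>v\<in>signed_axes. ?A v) = (\<Sum>v\<in>signed_axes. prob (?A v))"
    by (rule finite_measure_finite_Union)
       (auto simp: disjoint_family_on_def signed_axes_finite_card)
  also have "\<dots> = 1"
    using directions_uniform[of _ k] by (simp add: signed_axes_finite_card)
  finally have "AE \<omega> in M. \<omega> \<in> (\<Union>v\<in>signed_axes. ?A v)"
    by (subst (asm) prob_eq_1) (auto intro!: sets.finite_UN simp: signed_axes_finite_card)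
  thus "AE \<omega> in M. f k \<omega> \<in> signed_axes" by eventually_elim auto
qed

lemma AE_arrival_path: "AE \<omega> in M. arrival_path (\<lambda>k. \<tau> k \<omega>)"
  using arrivals_increasing arrivals_diverge AE_space
  by eventually_elim (simp add: arrival_path_def arrival_0)

lemma norm_char_step_le_1:
  "norm (\<integral>\<omega>. iexp (x * (g * f k \<omega> $ i + h * f k \<omega> $ j)) \<partial>M) \<le> 1"
proof -
  have "norm (\<integral>\<omega>. iexp (x * (g * f k \<omega> $ i + h * f k \<omega> $ j)) \<partial>M) \<le>
      (\<integral>\<omega>. norm (iexp (x * (g * f k \<omega> $ i + h * f k \<omega> $ j))) \<partial>M)"
    by (rule integral_norm_bound)
  thus ?thesis by (simp add: prob_space)
qed

text \<open>With probability \<open>1 / d\<close> the step is along the axis \<open>i\<close>, where the two signs average to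
  \<open>cos (x * g)\<close> and the coordinate \<open>j\<close> does not move. The other directions contribute at most their
  total probability.\<close>

lemma norm_char_step_le:
  assumes ij: "i \<noteq> j" and small: "\<bar>x * g\<bar> \<le> 1"
  shows "norm (\<integral>\<omega>. iexp (x * (g * f k \<omega> $ i + h * f k \<omega> $ j)) \<partial>M) \<le>
    1 - (x * g)\<^sup>2 / (4 * real CARD('d))"
proof -
  let ?d = "real CARD('d)"
  let ?e = "\<lambda>\<omega>. iexp (x * (g * f k \<omega> $ i + h * f k \<omega> $ j)) :: complex"
  define P N where "P = {\<omega> \<in> space M. f k \<omega> = axis i 1}" and "N = {\<omega> \<in> space M. f k \<omega> = - axis i 1}"
  define Q where "Q = space M - (P \<union> N)"
  have [measurable]: "P \<in> events" "N \<in> events" unfolding P_def N_def by measurable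
  have [measurable]: "Q \<in> events" unfolding Q_def by measurable
  have PN: "prob P = 1 / (2 * ?d)" "prob N = 1 / (2 * ?d)"
    unfolding P_def N_def by (rule directions_uniform, auto simp: signed_axes_def)+
  have "P \<inter> N = {}"
    by (auto simp: P_def N_def vec_eq_iff axis_def intro!: exI[of _ i])
  hence "prob (P \<union> N) = 1 / ?d" using PN by (subst finite_measure_Union) auto
  hence Q: "prob Q = 1 - 1 / ?d" unfolding Q_def by (subst prob_compl) auto
  \<comment> \<open>On \<open>P\<close> and \<open>N\<close> the coordinate \<open>j\<close> of the direction is \<open>0\<close>, as \<open>i \<noteq> j\<close>.\<close>
  have split: "?e \<omega> = indicator P \<omega> *\<^sub>R iexp (x * g) + indicator N \<omega> *\<^sub>R iexp (- (x * g)) + indicator Q \<omega> *\<^sub>R ?e \<omega>"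
    if "\<omega> \<in> space M" for \<omega>
    using that ij \<open>P \<inter> N = {}\<close> unfolding Q_def
    by (auto simp: P_def N_def indicator_def axis_def)
  have int: "integrable M (\<lambda>\<omega>. indicator A \<omega> *\<^sub>R (c :: complex))" if "A \<in> events" for A c
    using that by (intro integrable_const_bound[of _ "norm c"]) (auto simp: indicator_def)
  have val: "(\<integral>\<omega>. indicator A \<omega> *\<^sub>R (c :: complex) \<partial>M) = prob A *\<^sub>R c" if "A \<in> events" for A c
    using that by (subst integral_scaleR_left) (auto intro!: integrable_const_bound[of _ 1])
  have intQ: "integrable M (\<lambda>\<omega>. indicator Q \<omega> *\<^sub>R ?e \<omega>)"
  proof (rule integrable_const_bound[of _ 1])
    show "AE \<omega> in M. norm (indicator Q \<omega> *\<^sub>R ?e \<omega>) \<le> 1" by (auto simp: indicator_def)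
  qed measurable
  have "(\<integral>\<omega>. ?e \<omega> \<partial>M) = (\<integral>\<omega>. indicator P \<omega> *\<^sub>R iexp (x * g) + indicator N \<omega> *\<^sub>R iexp (- (x * g)) + indicator Q \<omega> *\<^sub>R ?e \<omega> \<partial>M)"
    by (rule Bochner_Integration.integral_cong[OF refl split])
  also have "\<dots> = prob P *\<^sub>R iexp (x * g) + prob N *\<^sub>R iexp (- (x * g)) + (\<integral>\<omega>. indicator Q \<omega> *\<^sub>R ?e \<omega> \<partial>M)"
    using int[of P] int[of N] intQ by (simp add: val)
  also have "prob P *\<^sub>R iexp (x * g) + prob N *\<^sub>R iexp (- (x * g)) = complex_of_real (cos (x * g) / ?d)"
    unfolding PN by (simp add: complex_eq_iff Re_exp Im_exp)
  also have "norm (complex_of_real (cos (x * g) / ?d) + (\<integral>\<omega>. indicator Q \<omega> *\<^sub>R ?e \<omega> \<partial>M)) \<le>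
      norm (complex_of_real (cos (x * g) / ?d)) + (\<integral>\<omega>. norm (indicator Q \<omega> *\<^sub>R ?e \<omega>) \<partial>M)"
    by (intro norm_triangle_le add_left_mono integral_norm_bound)
  also have "(\<integral>\<omega>. norm (indicator Q \<omega> *\<^sub>R ?e \<omega>) \<partial>M) = prob Q" by simp
  also have "norm (complex_of_real (cos (x * g) / ?d)) = cos (x * g) / ?d"
    unfolding norm_of_real using cos_le_quadratic(2)[OF small] by simp
  also have "cos (x * g) / ?d + prob Q \<le> (1 - (x * g)\<^sup>2 / 4) / ?d + (1 - 1 / ?d)"
    unfolding Q using cos_le_quadratic(1)[OF small] by (intro add_right_mono divide_right_mono) auto
  also have "\<dots> = 1 - (x * g)\<^sup>2 / (4 * ?d)" by (simp add: field_simps)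
  finally show ?thesis by simp
qed

text \<open>For fixed arrival times the displacement is a sum of independent terms.\<close>

lemma norm_char_given_arrivals:
  assumes s: "arrival_path s" and K: "\<And>k. s k \<le> t \<Longrightarrow> k < K"
  shows "norm (\<integral>\<omega>. iexp (g * displacement s (\<lambda>k. f k \<omega>) t i + h * displacement s (\<lambda>k. f k \<omega>) t j) \<partial>M) =
    (\<Prod>k<K. norm (\<integral>\<omega>. iexp (gap s t k * (g * f k \<omega> $ i + h * f k \<omega> $ j)) \<partial>M))"
proof -
  have disp: "displacement s v t c = (\<Sum>k<K. gap s t k * v k $ c)" for v :: "nat \<Rightarrow> real ^ 'd" and c
    by (rule displacement_eq_sum[OF s K])
  have "g * displacement s (\<lambda>k. f k \<omega>) t i + h * displacement s (\<lambda>k. f k \<omega>) t j =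
      (\<Sum>k<K. gap s t k * (g * f k \<omega> $ i + h * f k \<omega> $ j))" for \<omega>
    unfolding disp by (simp add: sum_distrib_left sum.distrib[symmetric] algebra_simps)
  hence "iexp (g * displacement s (\<lambda>k. f k \<omega>) t i + h * displacement s (\<lambda>k. f k \<omega>) t j) =
      (\<Prod>k<K. iexp (gap s t k * (g * f k \<omega> $ i + h * f k \<omega> $ j)))" for \<omega>
    by (simp add: exp_sum[symmetric] sum_distrib_left)
  moreover have "(\<integral>\<omega>. (\<Prod>k<K. iexp (gap s t k * (g * f k \<omega> $ i + h * f k \<omega> $ j))) \<partial>M) =
      (\<Prod>k<K. \<integral>\<omega>. iexp (gap s t k * (g * f k \<omega> $ i + h * f k \<omega> $ j)) \<partial>M)"
  proof (rule indep_vars_lebesgue_integral)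
    have "indep_vars (\<lambda>_. borel) f {..<K}" by (rule indep_vars_subset[OF directions_indep]) simp
    thus "indep_vars (\<lambda>_. borel) (\<lambda>k \<omega>. iexp (gap s t k * (g * f k \<omega> $ i + h * f k \<omega> $ j))) {..<K}"
      by (rule indep_vars_compose2) measurable
  qed (auto intro!: integrable_const_bound[of _ 1])
  ultimately show ?thesis by (simp add: prod_norm)
qed

lemma walk_coordinate_measurable [measurable]: "walk_coordinate \<tau> f t c \<in> borel_measurable M"
proof -
  note [measurable] = arrival_measurable
  show ?thesis unfolding walk_coordinate_def displacement_def gap_def by measurable
qed

text \<open>The estimate for a general rate: \<open>B\<close> blocks of cells of length \<open>l\<close> after time \<open>a\<close>, on which
  the rate lies between \<open>r\<close> and \<open>R\<close>. The condition \<open>3 * l * \<bar>g\<bar> \<le> 1\<close> keeps the phase \<open>x * g\<close>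
  small for every step length \<open>x \<le> 3 * l\<close> that a separated block produces.\<close>

lemma norm_char_le:
  assumes ij: "i \<noteq> j" and al: "0 \<le> a" "0 < l" and r0: "0 \<le> r"
    and r: "\<And>t. a \<le> t \<Longrightarrow> t < a + 3 * real B * l \<Longrightarrow> r \<le> rate t"
    and R: "\<And>t. a \<le> t \<Longrightarrow> t < a + 3 * real B * l \<Longrightarrow> rate t \<le> R"
    and t: "a + 3 * real B * l \<le> t" and small: "3 * l * \<bar>g\<bar> \<le> 1"
  shows "norm (\<integral>\<omega>. iexp (g * walk_coordinate \<tau> f t i \<omega> + h * walk_coordinate \<tau> f t j \<omega>) \<partial>M) \<le>
    exp (- (real B * ((l * g)\<^sup>2 / (4 * real CARD('d))) * ((1 - exp (- (r * l)))\<^sup>2 * exp (- (R * l)))))"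
proof -
  let ?d = "real CARD('d)"
  define \<delta> where "\<delta> = (l * g)\<^sup>2 / (4 * ?d)"
  have lg: "l * \<bar>g\<bar> \<le> 1" "0 \<le> l * \<bar>g\<bar>" using small al by auto
  have "(l * g)\<^sup>2 \<le> 1" using lg by (simp add: abs_square_le_1 abs_mult)
  moreover have "1 \<le> ?d" by (simp add: Suc_le_eq)
  ultimately have "(l * g)\<^sup>2 \<le> 4 * ?d" by linarith
  hence \<delta>: "0 \<le> \<delta>" "\<delta> \<le> 1" unfolding \<delta>_def by auto
  define \<psi> where "\<psi> k x = norm (\<integral>\<omega>. iexp (x * (g * f k \<omega> $ i + h * f k \<omega> $ j)) \<partial>M)" for k x
  have \<psi>: "0 \<le> \<psi> k x" "\<psi> k x \<le> 1" for k x
    unfolding \<psi>_def by (simp, rule norm_char_step_le_1)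
  have \<psi>_le: "\<psi> k x \<le> 1 - \<delta>" if "l \<le> x" "x \<le> 3 * l" for k x
  proof -
    have "\<bar>x * g\<bar> \<le> 3 * l * \<bar>g\<bar>" using that al by (auto simp: abs_mult intro!: mult_right_mono)
    hence "\<psi> k x \<le> 1 - (x * g)\<^sup>2 / (4 * ?d)"
      unfolding \<psi>_def using small by (intro norm_char_step_le[OF ij]) auto
    moreover have "(l * g)\<^sup>2 \<le> (x * g)\<^sup>2"
      using that al by (simp add: power_mult_distrib mult_right_mono power_mono)
    ultimately show ?thesis unfolding \<delta>_def by (smt (verit) divide_right_mono of_nat_0_le_iff)
  qed
  define T where "T \<omega> = (\<lambda>k. \<tau> (Suc k) \<omega>)" for \<omega>
  define F where "F \<omega> = (\<lambda>k. f k \<omega>)" for \<omega>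
  let ?\<Phi> = "\<lambda>s v. iexp (g * displacement (case_nat 0 s) v t i + h * displacement (case_nat 0 s) v t j)"
  let ?b = "\<lambda>\<omega>. \<Prod>m<B. 1 - \<delta> * of_bool (separated \<tau> a l m \<omega>)"
  note [measurable] = arrival_measurable
  have T[measurable]: "T \<in> M \<rightarrow>\<^sub>M PiM UNIV (\<lambda>_. borel)" unfolding T_def[abs_def]
    by (rule measurable_abs_UNIV) (rule arrival_measurable)
  have F[measurable]: "F \<in> M \<rightarrow>\<^sub>M PiM UNIV (\<lambda>_. borel)" unfolding F_def[abs_def]
    by (rule measurable_abs_UNIV) (rule direction_measurable)
  have [measurable]: "(\<lambda>s. case_nat 0 s k) \<in> borel_measurable (PiM UNIV (\<lambda>_. borel :: real measure))" for k
    by (cases k) simp_all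
  have \<Phi>[measurable]: "(\<lambda>(s, v). ?\<Phi> s v) \<in>
      borel_measurable (PiM UNIV (\<lambda>_. borel) \<Otimes>\<^sub>M PiM UNIV (\<lambda>_. borel))"
    unfolding displacement_def gap_def by measurable
  \<comment> \<open>The independence assumption concerns the arrivals from index \<open>1\<close> on; the origin is put back in front.\<close>
  have T_arr: "case_nat 0 (T \<omega>) = (\<lambda>k. \<tau> k \<omega>)" if "\<omega> \<in> space M" for \<omega>
    using arrival_0[OF that] by (auto simp: T_def fun_eq_iff split: nat.splits)
  have "(\<integral>\<omega>. iexp (g * walk_coordinate \<tau> f t i \<omega> + h * walk_coordinate \<tau> f t j \<omega>) \<partial>M) = (\<integral>\<omega>. (\<lambda>(s, v). ?\<Phi> s v) (T \<omega>, F \<omega>) \<partial>M)"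
    by (intro Bochner_Integration.integral_cong) (simp_all add: T_arr walk_coordinate_def F_def)
  also have "\<dots> = (\<integral>\<omega>'. (\<integral>\<omega>. (\<lambda>(s, v). ?\<Phi> s v) (T \<omega>', F \<omega>) \<partial>M) \<partial>M)"
  proof (rule integral_indep_pair[OF T F _ \<Phi>])
    show "indep_set {T -` A \<inter> space M |A. A \<in> sets (PiM UNIV (\<lambda>_. borel))}
        {F -` B \<inter> space M |B. B \<in> sets (PiM UNIV (\<lambda>_. borel))}"
      using directions_indep_arrivals unfolding T_def[abs_def] F_def[abs_def] .
  qed (auto simp: split_beta)
  also have "norm \<dots> \<le> (\<integral>\<omega>'. norm (\<integral>\<omega>. ?\<Phi> (T \<omega>') (F \<omega>) \<partial>M) \<partial>M)"
    unfolding prod.case by (rule integral_norm_bound)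
  also have "\<dots> \<le> expectation ?b"
  proof (rule integral_mono_AE)
    have "norm (\<integral>\<omega>. ?\<Phi> s (F \<omega>) \<partial>M) \<le> 1" for s
      using integral_norm_bound[of M "\<lambda>\<omega>. ?\<Phi> s (F \<omega>)"] by (simp add: prob_space)
    moreover have "(\<lambda>\<omega>'. \<integral>\<omega>. ?\<Phi> (T \<omega>') (F \<omega>) \<partial>M) \<in> borel_measurable M"
    proof (rule borel_measurable_lebesgue_integral)
      have "(\<lambda>p. (T (fst p), F (snd p))) \<in> M \<Otimes>\<^sub>M M \<rightarrow>\<^sub>M PiM UNIV (\<lambda>_. borel) \<Otimes>\<^sub>M PiM UNIV (\<lambda>_. borel)"
        by measurable
      from measurable_compose[OF this \<Phi>]
      show "(\<lambda>(\<omega>', \<omega>). ?\<Phi> (T \<omega>') (F \<omega>)) \<in> borel_measurable (M \<Otimes>\<^sub>M M)"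
        by (simp add: split_beta)
    qed
    ultimately show "integrable M (\<lambda>\<omega>'. norm (\<integral>\<omega>. ?\<Phi> (T \<omega>') (F \<omega>) \<partial>M))"
      by (intro integrable_const_bound[of _ 1]) simp_all
    have [measurable]: "separated \<tau> a l m \<in> measurable M (count_space UNIV)" for m
      using indep_separated[OF al, of "Suc m"] by (auto simp: indep_vars_def)
    have "\<bar>?b \<omega>\<bar> \<le> 1" for \<omega>
      unfolding abs_prod using \<delta> by (intro prod_le_1) (auto simp: of_bool_def)
    thus "integrable M ?b"
      by (intro integrable_const_bound[of _ 1]) simp_all
    show "AE \<omega>' in M. norm (\<integral>\<omega>. ?\<Phi> (T \<omega>') (F \<omega>) \<partial>M) \<le> ?b \<omega>'"
      using AE_arrival_path AE_space
    proof eventually_elim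
      case (elim \<omega>')
      let ?s = "\<lambda>k. \<tau> k \<omega>'"
      obtain K where K: "\<And>k. ?s k \<le> t \<Longrightarrow> k < K"
        using finite_arrivals_le[OF elim(1), of t] by (auto simp: finite_nat_set_iff_bounded)
      have "norm (\<integral>\<omega>. ?\<Phi> (T \<omega>') (F \<omega>) \<partial>M) = (\<Prod>k<K. \<psi> k (gap ?s t k))"
        unfolding T_arr[OF elim(2)] F_def \<psi>_def by (rule norm_char_given_arrivals[OF elim(1) K])
      also have "\<dots> \<le> ?b \<omega>'"
        by (rule prod_gaps_le[where \<tau> = \<tau> and \<omega> = \<omega>' and \<psi> = \<psi>, OF elim(1) al(2) \<delta> \<psi> \<psi>_le t K])
      finally show ?case .
    qed
  qed
  also have "\<dots> \<le> exp (- (real B * \<delta> * ((1 - exp (- (r * l)))\<^sup>2 * exp (- (R * l)))))"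
    by (rule expectation_prod_separated_le[OF al r0 \<delta> r R])
  finally show ?thesis unfolding \<delta>_def .
qed

end

section \<open>Summability along the integers\<close>

text \<open>Cauchy condensation turns the series into a multiple of that of \<open>n powr (- \<beta>)\<close>. It needs a
  decreasing sequence, so the first terms, where the logarithm vanishes, are replaced.\<close>

lemma summable_inverse_times_ln_powr:
  assumes "1 < \<beta>"
  shows "summable (\<lambda>n. 1 / (real n * ln (real n) powr \<beta>))"
proof -
  define f where "f n = 1 / (real (max 2 n) * ln (real (max 2 n)) powr \<beta>)" for n
  have ln2: "0 < ln (real (max 2 n))" for n by (subst ln_gt_zero_iff) auto
  have "f (Suc m) \<le> f m" for m
    unfolding f_def using ln2[of m] assms
    by (intro divide_left_mono mult_mono mult_pos_pos powr_mono2) auto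
  moreover have "0 \<le> f n" for n by (simp add: f_def)
  moreover have "summable (\<lambda>n. 2 ^ n * f (2 ^ n))"
  proof (rule summable_cong[THEN iffD1])
    show "summable (\<lambda>n. ln 2 powr (- \<beta>) * real n powr (- \<beta>))"
      using assms by (intro summable_mult) (simp add: summable_real_powr_iff)
    show "\<forall>\<^sub>F n in sequentially. ln 2 powr (- \<beta>) * real n powr (- \<beta>) = 2 ^ n * f (2 ^ n)"
    proof (rule eventually_sequentiallyI[of 1])
      fix n :: nat assume n: "1 \<le> n"
      have "(2 :: nat) ^ 1 \<le> 2 ^ n" using n by (rule power_increasing) simp
      hence m: "max 2 (2 ^ n) = (2 :: nat) ^ n" by simp
      have "ln (real (2 ^ n)) = real n * ln 2" by (simp add: ln_realpow)
      thus "ln 2 powr (- \<beta>) * real n powr (- \<beta>) = 2 ^ n * f (2 ^ n)"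
        by (simp add: f_def m powr_mult powr_minus field_simps)
    qed
  qed
  ultimately have "summable f" by (subst condensation_test) auto
  thus ?thesis
    by (rule summable_cong[THEN iffD1, rotated]) (auto simp: f_def eventually_sequentially intro!: exI[of _ 2])
qed

lemma summable_ln_powr_over_square:
  "summable (\<lambda>n. (ln (real n) powr \<beta>) / (real n)\<^sup>2)"
proof (rule summable_comparison_test_bigo)
  show "summable (\<lambda>n. norm (real n powr (- 3 / 2)))" by (simp add: summable_real_powr_iff)
  show "(\<lambda>n. (ln (real n) powr \<beta>) / (real n)\<^sup>2) \<in> O(\<lambda>n. real n powr (- 3 / 2))"
    by real_asymp
qed

lemma eventually_ln_powr_le:
  "eventually (\<lambda>n. 12 * ln (real n) powr \<beta> \<le> real n) sequentially"
  by real_asymp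

lemma (in orthogonal_conservative_walk) AE_walk_coordinate:
  "AE \<omega> in M. \<forall>t\<ge>0. \<forall>c. walk_coordinate \<tau> f t c \<omega> = walk \<tau> f t \<omega> $ c"
  using AE_arrival_path by eventually_elim (simp add: walk_coordinate_def displacement_eq_walk)

text \<open>The arithmetic of the exponent for \<open>r = 1 / L\<close> and \<open>R = C / L\<close>. The constant
  \<open>192 = 12 * 4 * 4\<close> collects the number of blocks, at least \<open>n / (12 * l)\<close> after rounding; the
  \<open>4\<close> in the loss per step; and \<open>1 - exp (- x) \<ge> x / 2\<close>, squared, for the two occupied cells.\<close>

lemma block_exponent_ge:
  fixes n l L g C d :: real
  assumes l: "0 < l" "l \<le> L" and n: "12 * L \<le> n" and C: "0 \<le> C" and d: "0 < d"
  shows "exp (- C) / (192 * d) * (n * l ^ 3 * g\<^sup>2 / L\<^sup>2) \<le>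
    real (nat \<lfloor>n / (6 * l)\<rfloor>) * ((l * g)\<^sup>2 / (4 * d)) *
      ((1 - exp (- (1 / L * l)))\<^sup>2 * exp (- (C / L * l)))"
proof -
  have L: "0 < L" using l by simp
  have B: "n / (12 * l) \<le> real (nat \<lfloor>n / (6 * l)\<rfloor>)"
  proof -
    have "2 \<le> n / (6 * l)" using l n by (simp add: field_simps)
    moreover have "n / (12 * l) = (n / (6 * l)) / 2" by simp
    ultimately show ?thesis by linarith
  qed
  define x where "x = l / L"
  have x: "0 \<le> x" "x \<le> 1" using l L by (auto simp: x_def)
  have "exp (- x) \<le> 1 / (1 + x)"
    using exp_ge_add_one_self[of x] x by (simp add: exp_minus field_simps)
  also have "\<dots> \<le> 1 - x / 2"
  proof -
    have "0 \<le> x * (1 - x)" using x by simp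
    thus ?thesis using x by (simp add: field_simps)
  qed
  finally have "x / 2 \<le> 1 - exp (- x)" by simp
  hence sq: "(x / 2)\<^sup>2 \<le> (1 - exp (- x))\<^sup>2" using x by (intro power_mono) auto
  have "C * x \<le> C" using mult_left_le[OF x(2) C] .
  hence e: "exp (- C) \<le> exp (- (C * x))" by simp
  have "n / (12 * l) * ((l * g)\<^sup>2 / (4 * d)) * ((x / 2)\<^sup>2 * exp (- C)) \<le>
      real (nat \<lfloor>n / (6 * l)\<rfloor>) * ((l * g)\<^sup>2 / (4 * d)) * ((1 - exp (- x))\<^sup>2 * exp (- (C * x)))"
    using d l n by (intro mult_mono[OF mult_right_mono[OF B] mult_mono[OF sq e]]) auto
  moreover have "n / (12 * l) * ((l * g)\<^sup>2 / (4 * d)) * ((x / 2)\<^sup>2 * exp (- C)) =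
      exp (- C) / (192 * d) * (n * l ^ 3 * g\<^sup>2 / L\<^sup>2)"
    using l d L by (simp add: x_def power2_eq_square power3_eq_cube field_simps)
  ultimately show ?thesis by (simp add: x_def)
qed

text \<open>Halving the time at most halves the logarithm, so between \<open>n / 2\<close> and \<open>n\<close> the rate is constant
  up to the factor \<open>2 powr \<beta>\<close>.\<close>

lemma log_rate_bounds_late:
  assumes \<beta>: "0 \<le> \<beta>" and n: "2 * exp 1 \<le> n" "4 \<le> n" and t: "n / 2 \<le> t" "t \<le> n"
  shows "1 / ln n powr \<beta> \<le> log_rate \<beta> t" "log_rate \<beta> t \<le> 2 powr \<beta> / ln n powr \<beta>"
proof -
  have pos: "0 < t" "0 < n" using n t by auto
  have e: "exp 1 \<le> t" using n t by simp
  have t1: "1 \<le> ln t" using e pos by (simp add: ln_ge_iff)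
  have tn: "ln t \<le> ln n" using pos t by simp
  have "ln n = ln (n / 2) + ln 2" using pos by (simp add: ln_div)
  moreover have "ln 2 \<le> ln (n / 2)" using n by (subst ln_le_cancel_iff) auto
  moreover have "ln (n / 2) \<le> ln t" using pos t by simp
  ultimately have nt: "ln n \<le> 2 * ln t" by linarith
  show "1 / ln n powr \<beta> \<le> log_rate \<beta> t"
    using e t1 tn \<beta> by (simp add: log_rate_def frac_le powr_mono2)
  have "ln n powr \<beta> \<le> (2 * ln t) powr \<beta>"
    using nt t1 tn \<beta> by (intro powr_mono2) auto
  also have "\<dots> = 2 powr \<beta> * ln t powr \<beta>" using t1 by (simp add: powr_mult)
  finally show "log_rate \<beta> t \<le> 2 powr \<beta> / ln n powr \<beta>"
    using e t1 tn by (simp add: log_rate_def field_simps)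
qed

text \<open>Written as a square because the geometric mean of this bound for \<open>g\<close> and of the one for \<open>h\<close>
  is then a product of a function of \<open>g\<close> and the same function of \<open>h\<close>.\<close>

lemma norm_char_log_rate_le:
  fixes f :: "nat \<Rightarrow> 'w \<Rightarrow> real ^ 'd" and n g h \<beta> :: real
  assumes walk: "orthogonal_conservative_walk M (log_rate \<beta>) \<tau> f" and \<beta>: "0 \<le> \<beta>"
    and ij: "i \<noteq> j" and n: "2 * exp 1 \<le> n" "4 \<le> n" "12 * ln n powr \<beta> \<le> n"
  defines "L \<equiv> ln n powr \<beta>" and "\<kappa> \<equiv> exp (- (2 powr \<beta>)) / (192 * real CARD('d))"
  shows "norm (\<integral>\<omega>. iexp (g * walk_coordinate \<tau> f n i \<omega> + h * walk_coordinate \<tau> f n j \<omega>) \<partial>M) \<le>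
    (exp (- (\<kappa> * n * L / 2) * g\<^sup>2) + 54 * L\<^sup>2 / (\<kappa> * n) * \<bar>g\<bar>)\<^sup>2" (is "?N \<le> _")
proof -
  interpret orthogonal_conservative_walk M "log_rate \<beta>" \<tau> f by (rule walk)
  have "1 < n" using n(2) by simp
  hence L: "0 < L" unfolding L_def by simp
  have \<kappa>: "0 < \<kappa>" unfolding \<kappa>_def by simp
  have main: "?N \<le> exp (- (\<kappa> * (n * l ^ 3 * g\<^sup>2 / L\<^sup>2)))"
    if l: "0 < l" "l \<le> L" "3 * l * \<bar>g\<bar> \<le> 1" for l
  proof -
    let ?B = "nat \<lfloor>n / (6 * l)\<rfloor>"
    have "real ?B \<le> n / (6 * l)" using l n by simp
    hence end_le: "n / 2 + 3 * real ?B * l \<le> n" using l by (simp add: field_simps)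
    have "?N \<le> exp (- (real ?B * ((l * g)\<^sup>2 / (4 * real CARD('d))) *
        ((1 - exp (- (1 / L * l)))\<^sup>2 * exp (- (2 powr \<beta> / L * l)))))"
    proof (rule norm_char_le[OF ij _ l(1)])
      fix t assume "n / 2 \<le> t" "t < n / 2 + 3 * real ?B * l"
      hence "n / 2 \<le> t" "t \<le> n" using end_le by auto
      thus "1 / L \<le> log_rate \<beta> t" "log_rate \<beta> t \<le> 2 powr \<beta> / L"
        unfolding L_def using log_rate_bounds_late[OF \<beta> n(1,2)] by auto
    qed (use n L l end_le in auto)
    also have "\<dots> \<le> exp (- (\<kappa> * (n * l ^ 3 * g\<^sup>2 / L\<^sup>2)))"
      unfolding \<kappa>_def using block_exponent_ge[OF l(1,2), of n "2 powr \<beta>" "real CARD('d)" g] n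
      by (simp add: L_def)
    finally show ?thesis .
  qed
  let ?a = "exp (- (\<kappa> * n * L / 2) * g\<^sup>2)" and ?b = "54 * L\<^sup>2 / (\<kappa> * n) * \<bar>g\<bar>"
  have nonneg: "0 \<le> ?a" "0 \<le> ?b" using \<kappa> n by auto
  show ?thesis
  proof (cases "3 * L * \<bar>g\<bar> \<le> 1")
    case True
    \<comment> \<open>Low frequency: cells as long as a typical step.\<close>
    have "?N \<le> exp (- (\<kappa> * (n * L ^ 3 * g\<^sup>2 / L\<^sup>2)))" using main[OF L _ True] by simp
    also have "\<dots> = ?a\<^sup>2"
      using L by (simp add: power2_eq_square power3_eq_cube mult_exp_exp)
    also have "\<dots> \<le> (?a + ?b)\<^sup>2" using nonneg by (intro power_mono) auto
    finally show ?thesis .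
  next
    case False
    hence g: "0 < \<bar>g\<bar>" using L by (cases "g = 0") auto
    \<comment> \<open>High frequency: the longest cells for which the phase stays bounded by \<open>1\<close>.\<close>
    define l where "l = 1 / (3 * \<bar>g\<bar>)"
    have l: "0 < l" "l \<le> L" "3 * l * \<bar>g\<bar> \<le> 1" using g False by (auto simp: l_def field_simps)
    define y where "y = \<kappa> * (n * l ^ 3 * g\<^sup>2 / L\<^sup>2)"
    have y: "0 < y" unfolding y_def using \<kappa> n l g L by auto
    have "y = \<kappa> * (n * l ^ 3 * \<bar>g\<bar>\<^sup>2 / L\<^sup>2)" by (simp add: y_def)
    also have "\<dots> = \<kappa> * n / (27 * \<bar>g\<bar> * L\<^sup>2)"
      unfolding l_def using g L by (simp only: power2_eq_square power3_eq_cube) (simp add: field_simps)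
    finally have "y = \<kappa> * n / (27 * \<bar>g\<bar> * L\<^sup>2)" .
    hence b: "2 / y = ?b" by simp
    \<comment> \<open>The bound \<open>2 / y\<close> for \<open>exp (- (y / 2))\<close> is linear in \<open>\<bar>g\<bar>\<close>, so it has a finite normal average;
      its constant is \<open>54 = 2 * 27\<close>.\<close>
    have "y / 2 \<le> exp (y / 2)" using exp_ge_add_one_self[of "y / 2"] by linarith
    hence "exp (- (y / 2)) \<le> 2 / y" using y by (simp add: exp_minus field_simps)
    hence "exp (- (y / 2)) ^ 2 \<le> ?b\<^sup>2" unfolding b by (intro power_mono) auto
    moreover have "exp (- (y / 2)) ^ 2 = exp (- y)" by (simp add: power2_eq_square mult_exp_exp)
    moreover have "?N \<le> exp (- y)" using main[OF l] by (simp only: y_def)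
    moreover have "?b\<^sup>2 \<le> (?a + ?b)\<^sup>2" using nonneg by (intro power_mono) auto
    ultimately show ?thesis by linarith
  qed
qed

text \<open>The expected order \<open>1 / (n * L)\<close> comes from low frequencies, the error term from high
  frequencies.\<close>

lemma prob_near_origin_le:
  fixes f :: "nat \<Rightarrow> 'w \<Rightarrow> real ^ 'd" and n R \<beta> :: real
  assumes walk: "orthogonal_conservative_walk M (log_rate \<beta>) \<tau> f" and \<beta>: "0 \<le> \<beta>"
    and ij: "i \<noteq> j" and n: "2 * exp 1 \<le> n" "4 \<le> n" "12 * ln n powr \<beta> \<le> n"
  defines "L \<equiv> ln n powr \<beta>" and "\<kappa> \<equiv> exp (- (2 powr \<beta>)) / (192 * real CARD('d))"
  shows "measure M {\<omega> \<in> space M. \<bar>walk_coordinate \<tau> f n i \<omega>\<bar> \<le> R \<and> \<bar>walk_coordinate \<tau> f n j \<omega>\<bar> \<le> R} \<le>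
    exp (R\<^sup>2) * (2 / \<kappa> * (1 / (n * L)) + 2 * (54 / \<kappa>)\<^sup>2 * (L ^ 4 / n\<^sup>2))"
proof -
  interpret orthogonal_conservative_walk M "log_rate \<beta>" \<tau> f by (rule walk)
  let ?N = std_normal_distribution
  have \<kappa>: "0 < \<kappa>" unfolding \<kappa>_def by simp
  have "1 < n" using n(2) by simp
  hence L: "0 < L" unfolding L_def by simp
  define a b where "a = \<kappa> * n * L / 2" and "b = 54 * L\<^sup>2 / (\<kappa> * n)"
  define H where "H g = exp (- a * g\<^sup>2) + b * \<bar>g\<bar>" for g
  have ab: "0 < a" "0 \<le> b" unfolding a_def b_def using \<kappa> L n by auto
  have H: "0 \<le> H g" for g unfolding H_def using ab by simp
  have int: "integrable ?N (\<lambda>g. exp (- a * g\<^sup>2))" "integrable ?N (\<lambda>g. b * \<bar>g\<bar>)"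
    using integral_exp_quadratic_std_normal(1)[of a] integral_abs_std_normal(1) ab by auto
  have EH: "(\<integral>g. H g \<partial>?N) \<le> 1 / sqrt (\<kappa> * n * L) + b"
  proof -
    have "(\<integral>g. H g \<partial>?N) = 1 / sqrt (1 + 2 * a) + b * (\<integral>g. \<bar>g\<bar> \<partial>?N)"
      unfolding H_def using int ab by (subst Bochner_Integration.integral_add) (simp_all only: integral_exp_quadratic_std_normal(2) integral_mult_right_zero less_imp_le)
    moreover have "1 / sqrt (1 + 2 * a) \<le> 1 / sqrt (\<kappa> * n * L)"
    proof (rule frac_le)
      have "0 < \<kappa> * n * L" using \<kappa> n L by simp
      thus "0 < sqrt (\<kappa> * n * L)" by simp
    qed (simp_all add: a_def)
    moreover have "b * (\<integral>g. \<bar>g\<bar> \<partial>?N) \<le> b"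
      using mult_left_le[OF integral_abs_std_normal(2) ab(2)] .
    ultimately show ?thesis by linarith
  qed
  have "prob {\<omega> \<in> space M. \<bar>walk_coordinate \<tau> f n i \<omega>\<bar> \<le> R \<and> \<bar>walk_coordinate \<tau> f n j \<omega>\<bar> \<le> R} \<le>
      exp (R\<^sup>2) * (\<integral>g. H g \<partial>?N)\<^sup>2"
  proof (rule small_ball_le_gaussian_average)
    show "H \<in> borel_measurable borel" unfolding H_def[abs_def] by measurable
    show "integrable ?N H" unfolding H_def[abs_def] using int by simp
    fix g h
    let ?E = "norm (\<integral>\<omega>. iexp (g * walk_coordinate \<tau> f n i \<omega> + h * walk_coordinate \<tau> f n j \<omega>) \<partial>M)"
    \<comment> \<open>The roles of the two coordinates are exchanged, and the two bounds are multiplied.\<close>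
    have "?E \<le> (H g)\<^sup>2"
      using norm_char_log_rate_le[OF walk \<beta> ij n, of g h] by (simp add: H_def a_def b_def L_def \<kappa>_def)
    moreover have "?E \<le> (H h)\<^sup>2"
      using norm_char_log_rate_le[OF walk \<beta> ij[symmetric] n, of h g]
      by (simp add: H_def a_def b_def L_def \<kappa>_def add.commute)
    ultimately have "?E * ?E \<le> (H g)\<^sup>2 * (H h)\<^sup>2" by (intro mult_mono) auto
    hence "?E\<^sup>2 \<le> (H g * H h)\<^sup>2" by (simp add: power2_eq_square mult_ac)
    thus "?E \<le> H g * H h" by (rule power2_le_imp_le) (simp add: H)
  qed measurable
  also have "\<dots> \<le> exp (R\<^sup>2) * (2 / \<kappa> * (1 / (n * L)) + 2 * (54 / \<kappa>)\<^sup>2 * (L ^ 4 / n\<^sup>2))"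
  proof (rule mult_left_mono)
    have "0 \<le> (\<integral>g. H g \<partial>?N)" using H by (intro integral_nonneg_AE) simp
    hence "(\<integral>g. H g \<partial>?N)\<^sup>2 \<le> (1 / sqrt (\<kappa> * n * L) + b)\<^sup>2" by (intro power_mono EH)
    also have "\<dots> \<le> 2 * (1 / sqrt (\<kappa> * n * L))\<^sup>2 + 2 * b\<^sup>2"
      using sum_squares_bound[of "1 / sqrt (\<kappa> * n * L)" b] by (simp add: power2_sum)
    also have "\<dots> = 2 / \<kappa> * (1 / (n * L)) + 2 * (54 / \<kappa>)\<^sup>2 * (L ^ 4 / n\<^sup>2)"
      using \<kappa> L n by (simp add: b_def power_divide power_mult_distrib power2_eq_square power4_eq_xxxx mult_ac)
    finally show "(\<integral>g. H g \<partial>?N)\<^sup>2 \<le> 2 / \<kappa> * (1 / (n * L)) + 2 * (54 / \<kappa>)\<^sup>2 * (L ^ 4 / n\<^sup>2)" .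
  qed simp
  finally show ?thesis .
qed

section \<open>Transience\<close>

theorem theorem3:
  fixes M :: "'w measure" and \<tau> :: "nat \<Rightarrow> 'w \<Rightarrow> real"
    and f :: "nat \<Rightarrow> 'w \<Rightarrow> real ^ 'd" and \<beta> :: real
  assumes "CARD('d) \<ge> 2" and "\<beta> > 2"
    and "orthogonal_conservative_walk M (log_rate \<beta>) \<tau> f"
  shows "AE \<omega> in M. transient_path (\<lambda>t. walk \<tau> f t \<omega>)"
proof -
  interpret orthogonal_conservative_walk M "log_rate \<beta>" \<tau> f by (rule assms(3))
  obtain i j :: 'd where ij: "i \<noteq> j"
    using assms(1) card_2_iff'[of "UNIV :: 'd set"] by (metis (full_types) card_le_Suc0_iff_eq finite numeral_2_eq_2 not_less_eq_eq)
  have \<beta>: "0 \<le> \<beta>" using assms(2) by simp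
  define \<kappa> where "\<kappa> = exp (- (2 powr \<beta>)) / (192 * real CARD('d))"
  define near where "near R n = {\<omega> \<in> space M. \<bar>walk_coordinate \<tau> f (real n) i \<omega>\<bar> \<le> real R \<and>
    \<bar>walk_coordinate \<tau> f (real n) j \<omega>\<bar> \<le> real R}" for R n :: nat
  have [measurable]: "near R n \<in> events" for R n unfolding near_def by measurable
  have "AE \<omega> in M. eventually (\<lambda>n. \<omega> \<in> space M - near R n) sequentially" for R
  proof (rule borel_cantelli_AE1)
    let ?u = "\<lambda>n :: nat. exp ((real R)\<^sup>2) * (2 / \<kappa> * (1 / (real n * ln (real n) powr \<beta>)) +
      2 * (54 / \<kappa>)\<^sup>2 * ((ln (real n) powr \<beta>) ^ 4 / (real n)\<^sup>2))"
    have "summable (\<lambda>n. (ln (real n) powr \<beta>) ^ 4 / (real n)\<^sup>2)"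
    proof -
      have "(ln (real n) powr \<beta>) ^ 4 = ln (real n) powr (4 * \<beta>)" for n
        using powr_numeral[of "ln (real n) powr \<beta>" "num.Bit0 (num.Bit0 num.One)"]
        by (simp add: powr_powr mult.commute)
      thus ?thesis using summable_ln_powr_over_square[of "4 * \<beta>"] by simp
    qed
    moreover have "summable (\<lambda>n. 1 / (real n * ln (real n) powr \<beta>))"
      by (rule summable_inverse_times_ln_powr) (use assms(2) in simp)
    ultimately have sum: "summable ?u" by (intro summable_mult summable_add)
    have "eventually (\<lambda>n. norm (prob (near R n)) \<le> ?u n) sequentially"
      using eventually_ln_powr_le[of \<beta>] eventually_ge_at_top[of "nat \<lceil>2 * exp 1 :: real\<rceil>"] eventually_ge_at_top[of 4]
    proof eventually_elim
      case (elim n)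
      have "2 * exp 1 \<le> real n" using elim(2) by linarith
      thus ?case
        using prob_near_origin_le[OF assms(3) \<beta> ij, of "real n" "real R"] elim
        unfolding near_def \<kappa>_def by simp
    qed
    thus "summable (\<lambda>n. prob (near R n))" using sum by (rule summable_comparison_test_ev)
  qed (simp_all add: less_top[symmetric])
  hence "AE \<omega> in M. \<forall>R. eventually (\<lambda>n. \<omega> \<in> space M - near R n) sequentially"
    by (simp add: AE_all_countable)
  thus ?thesis
    using AE_arrival_path AE_walk_coordinate directions_in_signed_axes
  proof eventually_elim
    case (elim \<omega>)
    show ?case
    proof (rule transient_path_if_integer_times[where \<tau> = \<tau> and f = f and \<omega> = \<omega> and i = i and j = j, OF elim(2)])
      show "\<bar>f k \<omega> $ c\<bar> \<le> 1" for k c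
        using elim(4) by (auto simp: signed_axes_def axis_def dest!: spec[of _ k])
      show "eventually (\<lambda>n. \<not> (\<bar>walk \<tau> f (real n) \<omega> $ i\<bar> \<le> real R \<and> \<bar>walk \<tau> f (real n) \<omega> $ j\<bar> \<le> real R)) sequentially" for R
        using elim(1)[rule_format, of R] by eventually_elim (use elim(3) in \<open>auto simp: near_def\<close>)
    qed
  qed
qed

end
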